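(* Let $s\in S$ and $\mathrm{TOL}>0$. Then the $L^\infty$-adaptive knot removal algorithm described in the context, applied to $\mathrm{TOL}$, the control points $\mathbf{c}$ of $s$ and the knot vector $\Xi$, finishes after a finite number of iterations and returns a spline $\hat s\in\hat S$ (where $\hat S$ is the spline space associated with the returned knot vector $\hat\Xi$ and $\hat s$ is the spline in $\hat S$ with the returned control points) such that $$\|s-\hat s\|_{L^\infty}<\mathrm{TOL}.$$
   Context: Splines. Fix a polynomial degree $p\in\mathbb{N}$ (positive integer), breakpoints $a=\zeta_1<\dots<\zeta_N=b$ and multiplicities $1\le m_j\le p+1$, $j=2,\dots,N-1$. $S$ is the space of piecewise polynomial functions of degree $\le p$ on these breakpoints having $p-m_j$ continuous derivatives at $\zeta_j$ (no continuity if $m_j=p+1$); $n:=\dim S=p+1+\sum_{j=2}^{N-1}m_j$. An associated $(p+1)$-basic knot vector is $\Xi=\{\xi_1,\dots,\xi_{n+p+1}\}$ with $\xi_1\le\dots\le\xi_{p+1}=\zeta_1$, followed by each interior breakpoint $\zeta_j$ repeated $m_j$ times in increasing order, followed by $\zeta_N=\xi_{n+1}\le\dots\le\xi_{n+p+1}$. $B_1,\dots,B_n$ is the B-spline basis of degree $p$ of $S$ associated with $\Xi$ (normalized to sum to one on $[a,b]$); the coefficients of a spline in it are its control points. For $s=\sum_{i=1}^n c_iB_i\in S$ put $\|s\|_{{\rm cp}\infty}:=\max_{1\le i\le n}|c_i|$; $L^\infty=L^\infty[a,b]$. Single knot removal. For an interior breakpoint index $j$ ($2\le j\le N-1$) let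 $i_0:=p+1+\sum_{r=2}^{j}m_r$ (the last index with $\xi_{i_0}=\zeta_j$) and $\ell:=m_j-1$. Let $\hat S_j\subset S$ be the spline space of degree $p$ associated with $\Xi\setminus\{\xi_{i_0}\}$, and $\mathbb{E}^{{\rm cp}\infty}_{\Xi,j}(s):=\min_{g\in\hat S_j}\|s-g\|_{{\rm cp}\infty}$, the norm being computed with the control points of $s-g$ in the basis of $S$ associated with $\Xi$. For $r=1,\dots,p+2-\ell$ let $\alpha_r:=\frac{\xi_{i_0}-\xi_{i_0-p-2+r}}{\xi_{i_0-1+r}-\xi_{i_0-p-2+r}}$. $A_{\rm loc}\in\mathbb{R}^{(p+2-\ell)\times(p+1-\ell)}$ has entries $(A_{\rm loc})_{r,r}=\alpha_r$, $(A_{\rm loc})_{r+1,r}=1-\alpha_{r+1}$ for $r=1,\dots,p+1-\ell$, and zeros elsewhere. Algorithm ($L^\infty$-adaptive knot removal). Input: $\mathrm{TOL}>0$, $\mathbf{c}$, $\Xi$. Let $k_{\max}:=\#\Xi-2(p+1)$ be the number of interior knots. Set $k=0$, $\mathbf{c}^{(0)}=\mathbf{c}$, $\Xi^{(0)}=\Xi$. For each $k$, $N^{(k)}$ is the number of breakpoints of $\Xi^{(k)}$, $s_k$ is the spline with control points $\mathbf{c}^{(k)}$ in the spline space of $\Xi^{(k)}$, $\varepsilon_j^{(k)}:=\mathbb{E}^{{\rm cp}\infty}_{\Xi^{(k)},j}(s_k)$ for $2\le j\le N^{(k)}-1$, and $j_*=j_*^{(k)}$ is an index minimizing $\varepsilon_j^{(k)}$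 over $2\le j\le N^{(k)}-1$. While $k<k_{\max}$ and $\varepsilon_{j_*}^{(k)}<\mathrm{TOL}$ (current value of $\mathrm{TOL}$), do: 1. replace $\mathrm{TOL}$ by $\mathrm{TOL}-\varepsilon_{j_*}^{(k)}$; 2. let $i_*$ and $\ell_*$ be the values of $i_0$ and $\ell$ for the breakpoint $j_*$ of $\Xi^{(k)}$, and let $\mathbf{c}_{\rm loc}^{(k)}:=(c^{(k)}_{i_*-p-1},\dots,c^{(k)}_{i_*-\ell_*})^T$; 3. let $\mathbf{c}_{\rm loc}^{(k+1)}:=\operatorname{argmin}_{\mathbf{z}\in\mathbb{R}^{p+1-\ell_*}}\|\mathbf{c}_{\rm loc}^{(k)}-A_{\rm loc}\mathbf{z}\|_\infty$ (this minimizer is unique), with $A_{\rm loc}$ built from $\Xi^{(k)}$ with $i_0=i_*$, $\ell=\ell_*$; 4. form $\mathbf{c}^{(k+1)}$ from $\mathbf{c}^{(k)}$ by replacing the block $\mathbf{c}_{\rm loc}^{(k)}$ by $\mathbf{c}_{\rm loc}^{(k+1)}$ (so $c_i^{(k+1)}=c_i^{(k)}$ for $i\le i_*-p-2$ and $c_i^{(k+1)}=c_{i+1}^{(k)}$ for $i\ge i_*-\ell_*$); 5. set $\Xi^{(k+1)}:=\Xi^{(k)}\setminus\{\xi^{(k)}_{i_*}\}$ and increase $k$ by one. Output: $\hat{\mathbf{c}}=\mathbf{c}^{(k)}$ and $\hat\Xi=\Xi^{(k)}$ for the final $k$. In the statement, $\mathrm{TOL}$ denotes the input value. *)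

theory Defs
  imports
    "HOL-Analysis.Analysis"
    "HOL-Probability.Essential_Supremum"
    "HOL-Computational_Algebra.Polynomial"
begin

text \<open>Finite sequences are lists; \<open>xs\<langle>i\<rangle>\<close> numbers their entries from 1.\<close>

abbreviation nth1 :: "'a list \<Rightarrow> nat \<Rightarrow> 'a"  (\<open>_\<langle>_\<rangle>\<close> [1000, 0] 1000)
  where "xs\<langle>i\<rangle> \<equiv> xs ! (i - 1)"

section \<open>Spline spaces\<close>

definition has_cont_derivs_at :: "nat \<Rightarrow> (real \<Rightarrow> real) \<Rightarrow> real \<Rightarrow> bool" where
  "has_cont_derivs_at k f x \<longleftrightarrow>
     (\<forall>r<k. eventually (\<lambda>y. (deriv ^^ r) f differentiable (at y)) (nhds x)) \<and>
     (\<forall>r\<le>k. isCont ((deriv ^^ r) f) x)"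

text \<open>Half-open pieces, except that the last one is closed: at a breakpoint of multiplicity
  \<open>p + 1\<close>, where no continuity is required, a spline takes its value from the right.\<close>

definition piece :: "real list \<Rightarrow> nat \<Rightarrow> real set" where
  "piece \<zeta> j = (if j = length \<zeta> - 1 then {\<zeta>\<langle>j\<rangle>..\<zeta>\<langle>j+1\<rangle>} else {\<zeta>\<langle>j\<rangle>..<\<zeta>\<langle>j+1\<rangle>})"

text \<open>Splines are functions on \<open>[a, b]\<close>: the values outside that interval are left arbitrary
  and are never used.\<close>

definition spline_space :: "nat \<Rightarrow> real list \<Rightarrow> (nat \<Rightarrow> nat) \<Rightarrow> (real \<Rightarrow> real) set" where
  "spline_space p \<zeta> m = {f.
     (\<forall>j\<in>{1..length \<zeta> - 1}. \<exists>P. degree P \<le> p \<and> (\<forall>x\<in>piece \<zeta> j. f x = poly P x)) \<and>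
     (\<forall>j\<in>{2..length \<zeta> - 1}. m j \<le> p \<longrightarrow> has_cont_derivs_at (p - m j) f (\<zeta>\<langle>j\<rangle>))}"

definition basic_knot_vector :: "nat \<Rightarrow> real list \<Rightarrow> (nat \<Rightarrow> nat) \<Rightarrow> real list \<Rightarrow> bool" where
  "basic_knot_vector p \<zeta> m \<Xi> \<longleftrightarrow>
     (\<exists>L R. \<Xi> = L @ concat (map (\<lambda>j. replicate (m j) (\<zeta>\<langle>j\<rangle>)) [2..<length \<zeta>]) @ R \<and>
        length L = p + 1 \<and> sorted L \<and> last L = hd \<zeta> \<and>
        length R = p + 1 \<and> sorted R \<and> hd R = last \<zeta>)"

definition spline_dim :: "nat \<Rightarrow> real list \<Rightarrow> nat" where
  "spline_dim p \<Xi> = length \<Xi> - (p + 1)"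

text \<open>Breakpoints and multiplicities recovered from a \<open>(p+1)\<close>-basic knot vector. An interior
  breakpoint differs from all the auxiliary knots, so its multiplicity can be counted in the
  whole of \<open>\<Xi>\<close>; \<open>knot_mult\<close> is only used for interior breakpoints.\<close>

definition breakpoints :: "nat \<Rightarrow> real list \<Rightarrow> real list" where
  "breakpoints p \<Xi> = sorted_list_of_set ((\<lambda>i. \<Xi>\<langle>i\<rangle>) ` {p+1..spline_dim p \<Xi> + 1})"

definition knot_mult :: "nat \<Rightarrow> real list \<Rightarrow> nat \<Rightarrow> nat" where
  "knot_mult p \<Xi> j = count_list \<Xi> ((breakpoints p \<Xi>)\<langle>j\<rangle>)"

definition spline_space_of_knots :: "nat \<Rightarrow> real list \<Rightarrow> (real \<Rightarrow> real) set" where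
  "spline_space_of_knots p \<Xi> = spline_space p (breakpoints p \<Xi>) (knot_mult p \<Xi>)"

section \<open>B-splines and control points\<close>

text \<open>Cox--de Boor recursion; terms with vanishing denominator are 0 since \<open>x / 0 = 0\<close>.
  The functions are right-continuous, except that at the right end \<open>b\<close> of the interval they take
  the value of their left limit.\<close>

fun cox_de_boor :: "real list \<Rightarrow> real \<Rightarrow> nat \<Rightarrow> nat \<Rightarrow> real \<Rightarrow> real" where
  "cox_de_boor \<Xi> b 0 i x =
     (if (if x < b then \<Xi>\<langle>i\<rangle> \<le> x \<and> x < \<Xi>\<langle>i+1\<rangle> else \<Xi>\<langle>i\<rangle> < x \<and> x \<le> \<Xi>\<langle>i+1\<rangle>) then 1 else 0)"
| "cox_de_boor \<Xi> b (Suc q) i x =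
     (x - \<Xi>\<langle>i\<rangle>) / (\<Xi>\<langle>i+q+1\<rangle> - \<Xi>\<langle>i\<rangle>) * cox_de_boor \<Xi> b q i x +
     (\<Xi>\<langle>i+q+2\<rangle> - x) / (\<Xi>\<langle>i+q+2\<rangle> - \<Xi>\<langle>i+1\<rangle>) * cox_de_boor \<Xi> b q (i+1) x"

definition bspline :: "nat \<Rightarrow> real list \<Rightarrow> nat \<Rightarrow> real \<Rightarrow> real" where
  "bspline p \<Xi> i = cox_de_boor \<Xi> (\<Xi>\<langle>spline_dim p \<Xi> + 1\<rangle>) p i"

definition spline :: "nat \<Rightarrow> real list \<Rightarrow> real list \<Rightarrow> real \<Rightarrow> real" where
  "spline p \<Xi> c x = (\<Sum>i=1..spline_dim p \<Xi>. c\<langle>i\<rangle> * bspline p \<Xi> i x)"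

definition control_points :: "nat \<Rightarrow> real list \<Rightarrow> (real \<Rightarrow> real) \<Rightarrow> real list" where
  "control_points p \<Xi> f = (THE c. length c = spline_dim p \<Xi> \<and>
     (\<forall>x\<in>{\<Xi>\<langle>p+1\<rangle>..\<Xi>\<langle>spline_dim p \<Xi> + 1\<rangle>}. f x = spline p \<Xi> c x))"

definition cp_norm :: "nat \<Rightarrow> real list \<Rightarrow> (real \<Rightarrow> real) \<Rightarrow> real" where
  "cp_norm p \<Xi> f = (MAX i\<in>{1..spline_dim p \<Xi>}. \<bar>(control_points p \<Xi> f)\<langle>i\<rangle>\<bar>)"

definition Linf_norm :: "real \<Rightarrow> real \<Rightarrow> (real \<Rightarrow> real) \<Rightarrow> ereal" where
  "Linf_norm a b f = esssup (lebesgue_on {a..b}) (\<lambda>x. ereal \<bar>f x\<bar>)"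

section \<open>Removal of a single knot\<close>

definition last_knot_index :: "nat \<Rightarrow> real list \<Rightarrow> nat \<Rightarrow> nat" where
  "last_knot_index p \<Xi> j = p + 1 + (\<Sum>r=2..j. knot_mult p \<Xi> r)"

definition remove_index :: "nat \<Rightarrow> 'a list \<Rightarrow> 'a list" where
  "remove_index i xs = take (i - 1) xs @ drop i xs"

text \<open>The minimum over \<open>g\<close>, written as an infimum (it is attained, the space being
  finite-dimensional on \<open>[a, b]\<close>).\<close>

definition knot_removal_error :: "nat \<Rightarrow> real list \<Rightarrow> nat \<Rightarrow> (real \<Rightarrow> real) \<Rightarrow> real" where
  "knot_removal_error p \<Xi> j s =
     (INF g\<in>spline_space_of_knots p (remove_index (last_knot_index p \<Xi> j) \<Xi>).
        cp_norm p \<Xi> (\<lambda>x. s x - g x))"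

text \<open>For \<open>1 \<le> r \<le> p + 2 - \<ell>\<close> no index below falls under 1, as \<open>i\<^sub>0 \<ge> p + 2\<close> for
  an interior breakpoint.\<close>

definition alpha :: "nat \<Rightarrow> real list \<Rightarrow> nat \<Rightarrow> nat \<Rightarrow> real" where
  "alpha p \<Xi> i\<^sub>0 r =
     (\<Xi>\<langle>i\<^sub>0\<rangle> - \<Xi>\<langle>i\<^sub>0 + r - (p + 2)\<rangle>) / (\<Xi>\<langle>i\<^sub>0 + r - 1\<rangle> - \<Xi>\<langle>i\<^sub>0 + r - (p + 2)\<rangle>)"

text \<open>Entry \<open>(r, t)\<close> of the \<open>(p + 2 - \<ell>) \<times> (p + 1 - \<ell>)\<close> matrix; the range of the indices is
  imposed where the matrix is used.\<close>

definition A_loc :: "nat \<Rightarrow> real list \<Rightarrow> nat \<Rightarrow> nat \<Rightarrow> nat \<Rightarrow> real" where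
  "A_loc p \<Xi> i\<^sub>0 r t =
     (if r = t then alpha p \<Xi> i\<^sub>0 r else if r = t + 1 then 1 - alpha p \<Xi> i\<^sub>0 r else 0)"

definition c_loc :: "nat \<Rightarrow> nat \<Rightarrow> nat \<Rightarrow> real list \<Rightarrow> real list" where
  "c_loc p i\<^sub>0 l c = map (\<lambda>i. c\<langle>i\<rangle>) [i\<^sub>0 - p - 1..<i\<^sub>0 - l + 1]"

definition loc_residual :: "nat \<Rightarrow> real list \<Rightarrow> nat \<Rightarrow> nat \<Rightarrow> real list \<Rightarrow> real list \<Rightarrow> real" where
  "loc_residual p \<Xi> i\<^sub>0 l c z =
     (MAX r\<in>{1..p+2-l}.
        \<bar>(c_loc p i\<^sub>0 l c)\<langle>r\<rangle> - (\<Sum>t=1..p+1-l. A_loc p \<Xi> i\<^sub>0 r t * z\<langle>t\<rangle>)\<bar>)"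

section \<open>The adaptive algorithm\<close>

definition best_index :: "nat \<Rightarrow> real list \<Rightarrow> real list \<Rightarrow> nat \<Rightarrow> bool" where
  "best_index p \<Xi> c j \<longleftrightarrow>
     is_arg_min (\<lambda>i. knot_removal_error p \<Xi> i (spline p \<Xi> c))
       (\<lambda>i. i \<in> {2..length (breakpoints p \<Xi>) - 1}) j"

text \<open>A state consists of the counter \<open>k\<close>, the current tolerance, the control points and the knot
  vector. The loop is a transition relation, since a minimizing breakpoint need not be unique:
  all ways of breaking ties are admitted.\<close>

type_synonym state = "nat \<times> real \<times> real list \<times> real list"

fun loop_condition :: "nat \<Rightarrow> nat \<Rightarrow> state \<Rightarrow> bool" where
  "loop_condition p k_max (k, tol, c, \<Xi>) \<longleftrightarrow>
     k < k_max \<and> (\<exists>j. best_index p \<Xi> c j \<and> knot_removal_error p \<Xi> j (spline p \<Xi> c) < tol)"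

inductive loop_step :: "nat \<Rightarrow> nat \<Rightarrow> state \<Rightarrow> state \<Rightarrow> bool" for p k_max where
  "loop_step p k_max (k, tol, c, \<Xi>)
     (k + 1, tol - \<epsilon>, take (i - p - 2) c @ z @ drop (i - l) c, remove_index i \<Xi>)"
  if "k < k_max"
    and "best_index p \<Xi> c j"
    and "\<epsilon> = knot_removal_error p \<Xi> j (spline p \<Xi> c)"
    and "\<epsilon> < tol"
    and "i = last_knot_index p \<Xi> j"
    and "l = knot_mult p \<Xi> j - 1"
    and "is_arg_min (loc_residual p \<Xi> i l c) (\<lambda>z. length z = p + 1 - l) z"

definition max_removals :: "nat \<Rightarrow> real list \<Rightarrow> nat" where
  "max_removals p \<Xi> = length \<Xi> - 2 * (p + 1)"

text \<open>The algorithm finishes: there is no infinite run, and no run gets stuck, i.e.\ as long as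
  the loop condition holds the loop body can be executed.\<close>

definition algorithm_finishes :: "nat \<Rightarrow> real \<Rightarrow> real list \<Rightarrow> real list \<Rightarrow> bool" where
  "algorithm_finishes p TOL c \<Xi> \<longleftrightarrow>
     (\<nexists>\<sigma>. \<sigma> 0 = (0, TOL, c, \<Xi>) \<and> (\<forall>k. loop_step p (max_removals p \<Xi>) (\<sigma> k) (\<sigma> (Suc k)))) \<and>
     (\<forall>st. (loop_step p (max_removals p \<Xi>))\<^sup>*\<^sup>* (0, TOL, c, \<Xi>) st \<and>
        loop_condition p (max_removals p \<Xi>) st \<longrightarrow>
          (\<exists>st'. loop_step p (max_removals p \<Xi>) st st'))"

definition algorithm_returns ::
  "nat \<Rightarrow> real \<Rightarrow> real list \<Rightarrow> real list \<Rightarrow> real list \<Rightarrow> real list \<Rightarrow> bool" where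
  "algorithm_returns p TOL c \<Xi> c' \<Xi>' \<longleftrightarrow>
     (\<exists>k tol. (loop_step p (max_removals p \<Xi>))\<^sup>*\<^sup>* (0, TOL, c, \<Xi>) (k, tol, c', \<Xi>') \<and>
        \<not> loop_condition p (max_removals p \<Xi>) (k, tol, c', \<Xi>'))"

end

theory Submission
  imports Defs
begin

text \<open>
  On a nonempty knot interval, the de Boor--Fix pairing
  \<open>\<langle>P, Q\<rangle> = (\<Sum>r\<le>p. (-1)^r P^(r)(\<tau>) Q^(p-r)(\<tau>)) / p!\<close>, which does not depend on \<open>\<tau>\<close>, together with
  Marsden's identity shows that \<open>\<langle>P, \<psi>\<^sub>i\<rangle>\<close>, \<open>\<psi>\<^sub>i(y) = (y - \<xi>\<^sub>i\<^sub>+\<^sub>1)\<dots>(y - \<xi>\<^sub>i\<^sub>+\<^sub>p)\<close>, are the B-spline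
  coefficients of \<open>P\<close>. Everything about B-splines follows from this duality: local linear independence,
  the derivative formula (hence smoothness), the fact that splines are combinations of B-splines (the
  pairings of two adjacent pieces with \<open>\<psi>\<^sub>i\<close> agree, since at the breakpoint each term has a vanishing
  factor), and Boehm's knot insertion (a linear relation between the \<open>\<psi>\<^sub>i\<close>).

  By knot insertion, the local residual of the algorithm bounds the control point distance between
  consecutive splines, and its minimum is at most the removal error \<open>\<epsilon>\<close>. As B-splines are nonnegative
  and sum to one, each step changes the spline by at most \<open>\<epsilon>\<close> in the maximum norm, while the
  tolerance decreases by \<open>\<epsilon>\<close> and stays positive.
\<close>

section \<open>Polynomial pieces of B-splines and their dual functionals\<close>

text \<open>After a few removals a knot vector is no longer described by the initial breakpoints and
  multiplicities. The locale \<open>knot_vector\<close> therefore keeps only inequalities between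
  knots that survive the removal of an interior knot; breakpoints and multiplicities are read off
  the vector itself. Repeated knots are the reason for working with polynomials: the recursion is
  read on a single nonempty knot interval, where every denominator that matters is positive. The
  minimal residual is at most \<open>\<epsilon>\<close> because the bidiagonal matrix is a block of
  Boehm's insertion matrix. For any competitor \<open>g\<close> with coefficients \<open>d\<close>,
  the residual of the corresponding block of \<open>d\<close> is the maximum of the control points
  of \<open>s - g\<close> over a few indices only. For the new control points, insertion reproduces
  the old ones outside this block, so there the residual bounds all control points of the
  difference. A run must also never get stuck, which requires a minimizer. It is written down
  explicitly, from the vector orthogonal to the range of the matrix.\<close>

definition psi :: "(nat \<Rightarrow> real) \<Rightarrow> nat \<Rightarrow> nat \<Rightarrow> real poly" where
  "psi t q i = (\<Prod>l\<in>{i+1..i+q}. [:- t l, 1:])"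

text \<open>The polynomial with which the \<open>i\<close>-th B-spline of degree \<open>q\<close> agrees on \<open>[t\<^sub>k, t\<^sub>k\<^sub>+\<^sub>1)\<close>.\<close>

fun bpoly :: "(nat \<Rightarrow> real) \<Rightarrow> nat \<Rightarrow> nat \<Rightarrow> nat \<Rightarrow> real poly" where
  "bpoly t k 0 i = (if i = k then 1 else 0)"
| "bpoly t k (Suc q) i =
     smult (1 / (t (i+q+1) - t i)) ([:- t i, 1:] * bpoly t k q i) +
     smult (1 / (t (i+q+2) - t (i+1))) ([:t (i+q+2), -1:] * bpoly t k q (i+1))"

lemma bpoly_eq_0: "k < i \<or> i + q < k \<Longrightarrow> bpoly t k q i = 0"
  by (induction q arbitrary: i) auto

lemma degree_bpoly: "degree (bpoly t k q i) \<le> q"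
proof (induction q arbitrary: i)
  case (Suc q)
  have "degree ([:u, v:] * bpoly t k q j) \<le> Suc q" for u v j
    using degree_mult_le[of "[:u, v:]" "bpoly t k q j"] Suc[of j] degree_pCons_le[of u "[:v:]"] by simp
  then show ?case
    by (auto intro!: degree_add_le order_trans[OF degree_smult_le] simp del: mult_pCons_left)
qed auto

lemma poly_bpoly_Suc:
  "poly (bpoly t k (Suc q) i) x =
     (x - t i) / (t (i+q+1) - t i) * poly (bpoly t k q i) x +
     (t (i+q+2) - x) / (t (i+q+2) - t (i+1)) * poly (bpoly t k q (i+1)) x"
  by (simp add: left_diff_distrib diff_divide_distrib)

lemma poly_psi: "poly (psi t q i) y = (\<Prod>l\<in>{i+1..i+q}. y - t l)"
  by (simp add: psi_def poly_prod)

lemma degree_psi: "degree (psi t q i) \<le> q"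
  unfolding psi_def by (rule order_trans[OF degree_prod_sum_le]) simp_all

text \<open>One step of de Boor's algorithm: the recursion is resorted by the index of the
  lower-degree pieces, and the surplus terms, with indices \<open>k - Suc q\<close> and
  \<open>Suc k\<close>, vanish on piece \<open>k\<close>. Constant \<open>f\<close> gives the
  partition of unity, \<open>f = psi\<close> gives Marsden's identity.\<close>

lemma sum_bpoly_Suc:
  fixes f :: "nat \<Rightarrow> real"
  assumes t: "mono t" "t k < t (Suc k)" and q: "Suc q \<le> k"
  shows "(\<Sum>i=k-Suc q..k. f i * poly (bpoly t k (Suc q) i) x) =
    (\<Sum>i=k-q..k. poly (bpoly t k q i) x *
       ((x - t i) / (t (i+q+1) - t i) * f i + (1 - (x - t i) / (t (i+q+1) - t i)) * f (i-1)))"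
proof -
  define u where "u i = (x - t i) / (t (i+q+1) - t i)" for i
  define w where "w i = (t (i+q+1) - x) / (t (i+q+1) - t i)" for i
  define B where "B i = poly (bpoly t k q i) x" for i
  \<comment> \<open>The nonempty interval of piece \<open>k\<close> lies inside
    \<open>[t i, t (i+q+1)]\<close>, so the common denominator is positive.\<close>
  have w: "w i = 1 - u i" if "i \<in> {k-q..k}" for i
  proof -
    have "t i \<le> t k" "t (Suc k) \<le> t (i+q+1)" using that q by (auto intro!: monoD[OF t(1)])
    with t(2) show ?thesis by (simp add: w_def u_def field_simps)
  qed
  have "(\<Sum>i=k-Suc q..k. f i * poly (bpoly t k (Suc q) i) x) =
     (\<Sum>i=k-Suc q..k. f i * u i * B i) + (\<Sum>i=k-Suc q..k. f i * w (Suc i) * B (Suc i))"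
    unfolding poly_bpoly_Suc sum.distrib[symmetric]
    by (intro sum.cong) (simp_all add: u_def w_def B_def algebra_simps)
  also have "(\<Sum>i=k-Suc q..k. f i * u i * B i) = (\<Sum>i=k-q..k. f i * u i * B i)"
    by (rule sum.mono_neutral_right) (use q in \<open>auto simp: B_def bpoly_eq_0\<close>)
  also have "(\<Sum>i=k-Suc q..k. f i * w (Suc i) * B (Suc i)) = (\<Sum>i=Suc (k-Suc q)..Suc k. f (i-1) * w i * B i)"
    by (subst sum.atLeast_Suc_atMost_Suc_shift) simp
  also have "\<dots> = (\<Sum>i=k-q..k. f (i-1) * w i * B i)"
    by (rule sum.mono_neutral_right) (use q in \<open>auto simp: B_def bpoly_eq_0\<close>)
  also have "\<dots> = (\<Sum>i=k-q..k. f (i-1) * (1 - u i) * B i)"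
    by (intro sum.cong) (simp_all add: w)
  also have "(\<Sum>i=k-q..k. f i * u i * B i) + \<dots> = (\<Sum>i=k-q..k. B i * (u i * f i + (1 - u i) * f (i-1)))"
    by (simp add: sum.distrib[symmetric] distrib_left mult_ac)
  finally show ?thesis by (simp only: u_def B_def)
qed

lemma sum_bpoly_eq_1:
  assumes "mono t" "t k < t (Suc k)" "q \<le> k"
  shows "(\<Sum>i=k-q..k. poly (bpoly t k q i) x) = 1"
  using assms(3)
proof (induction q)
  case (Suc q)
  then show ?case using sum_bpoly_Suc[OF assms(1,2) Suc.prems, of "\<lambda>_. 1" x] by (simp del: bpoly.simps)
qed simp

text \<open>Induction on the degree. The two neighbouring products of degree \<open>q+1\<close>
  share \<open>psi t q i\<close> and differ in one factor, \<open>y - t (i+q+1)\<close> against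
  \<open>y - t i\<close>; the weights of de Boor's step average these factors to
  \<open>y - x\<close>.\<close>

theorem marsden:
  assumes t: "mono t" "t k < t (Suc k)" and "q \<le> k"
  shows "(\<Sum>i=k-q..k. poly (psi t q i) y * poly (bpoly t k q i) x) = (y - x) ^ q"
  using assms(3)
proof (induction q)
  case 0
  then show ?case by (simp add: psi_def)
next
  case (Suc q)
  have *: "(x - t i) / (t (i+q+1) - t i) * poly (psi t (Suc q) i) y +
        (1 - (x - t i) / (t (i+q+1) - t i)) * poly (psi t (Suc q) (i-1)) y =
        poly (psi t q i) y * (y - x)" if i: "i \<in> {k-q..k}" for i
  proof -
    have "t i \<le> t k" "t (Suc k) \<le> t (i+q+1)"
      using i Suc.prems by (auto intro!: monoD[OF t(1)])
    with t(2) have ne: "t (i+q+1) \<noteq> t i" by simp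
    have 1: "poly (psi t (Suc q) i) y = poly (psi t q i) y * (y - t (i+q+1))"
      by (simp add: poly_psi)
    have "i > 0" using i Suc.prems by auto
    then have "poly (psi t (Suc q) (i-1)) y = (\<Prod>l\<in>{i..i+q}. y - t l)"
      by (simp add: poly_psi)
    also have "\<dots> = (y - t i) * poly (psi t q i) y"
      by (subst prod.atLeast_Suc_atMost) (simp_all add: poly_psi)
    finally have 2: "poly (psi t (Suc q) (i-1)) y = (y - t i) * poly (psi t q i) y" .
    define u where "u = (x - t i) / (t (i+q+1) - t i)"
    have "u * (t (i+q+1) - t i) = x - t i" using ne by (simp add: u_def)
    then have "y - x = (y - t i) - u * (t (i+q+1) - t i)" by simp
    moreover have "u * (poly (psi t q i) y * (y - t (i+q+1))) + (1 - u) * ((y - t i) * poly (psi t q i) y) =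
        poly (psi t q i) y * ((y - t i) - u * (t (i+q+1) - t i))"
      by (simp add: algebra_simps)
    ultimately show ?thesis unfolding 1 2 u_def[symmetric] by simp
  qed
  have "(\<Sum>i=k-Suc q..k. poly (psi t (Suc q) i) y * poly (bpoly t k (Suc q) i) x) =
     (\<Sum>i=k-q..k. poly (bpoly t k q i) x * (poly (psi t q i) y * (y - x)))"
    unfolding sum_bpoly_Suc[OF t Suc.prems] by (intro sum.cong refl) (simp only: *)
  also have "\<dots> = (y - x) * (\<Sum>i=k-q..k. poly (psi t q i) y * poly (bpoly t k q i) x)"
    by (simp add: sum_distrib_left algebra_simps)
  finally show ?case using Suc by simp
qed

lemma bpoly_nonneg:
  assumes t: "mono t" and x: "t k \<le> x" "x \<le> t (Suc k)"
  shows "poly (bpoly t k q i) x \<ge> 0"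
proof (induction q arbitrary: i)
  case (Suc q)
  have 1: "(x - t i) / (t (i+q+1) - t i) * poly (bpoly t k q i) x \<ge> 0"
  \<comment> \<open>A weight can be negative only where the polynomial that it multiplies is
    zero.\<close>
  proof (cases "i \<le> k \<and> k \<le> i + q")
    case True
    then have "t i \<le> t k" "t i \<le> t (i+q+1)" by (auto intro!: monoD[OF t])
    with x Suc show ?thesis by simp
  qed (auto simp: bpoly_eq_0)
  have 2: "(t (i+q+2) - x) / (t (i+q+2) - t (i+1)) * poly (bpoly t k q (i+1)) x \<ge> 0"
  proof (cases "i + 1 \<le> k \<and> k \<le> i + 1 + q")
    case True
    then have "t (Suc k) \<le> t (i+q+2)" "t (i+1) \<le> t (i+q+2)" by (auto intro!: monoD[OF t])
    with x Suc show ?thesis by simp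
  qed (auto simp: bpoly_eq_0)
  show ?case unfolding poly_bpoly_Suc using 1 2 by simp
qed auto

section \<open>Iterated derivatives of polynomials and the de Boor-Fix pairing\<close>

abbreviation pderivs :: "nat \<Rightarrow> real poly \<Rightarrow> real poly" where
  "pderivs r \<equiv> (pderiv ^^ r)"

lemma pderivs_eq_0: "degree P < r \<Longrightarrow> pderivs r P = 0"
proof (induction r arbitrary: P)
  case (Suc r)
  show ?case
  proof (cases "degree P = 0")
    case True
    then obtain c where "P = [:c:]" by (metis degree_eq_zeroE)
    then show ?thesis by (simp add: funpow_Suc_right del: funpow.simps)
  next
    case False
    with Suc have "degree (pderiv P) < r" by (simp add: degree_pderiv)
    from Suc.IH[OF this] show ?thesis by (simp add: funpow_Suc_right del: funpow.simps)
  qed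
qed simp

lemma pderivs_linear:
  "pderivs r (P + Q) = pderivs r P + pderivs r Q"
  "pderivs r (P - Q) = pderivs r P - pderivs r Q"
  "pderivs r (smult c P) = smult c (pderivs r P)"
  "pderivs r 0 = 0"
  by (induction r) (simp_all add: pderiv_add pderiv_diff pderiv_smult)

lemma root_power_dvd_pderivs:
  assumes "[:- z, 1:] ^ m dvd P" shows "[:- z, 1:] ^ (m - r) dvd pderivs r P"
proof (induction r)
  case (Suc r)
  have *: "[:- z, 1:] ^ (j - 1) dvd pderiv Q" if "[:- z, 1:] ^ j dvd Q" for j and Q :: "real poly"
  proof (cases j)
    case (Suc i)
    from that Suc obtain R where "Q = [:- z, 1:] ^ Suc i * R" unfolding dvd_def by blast
    then have "pderiv Q = [:- z, 1:] ^ i * ([:- z, 1:] * pderiv R + smult (of_nat (Suc i)) (R * pderiv [:- z, 1:]))"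
      by (simp only: pderiv_mult pderiv_power_Suc) (simp add: algebra_simps)
    then show ?thesis using Suc by simp
  qed simp
  show ?case using *[OF Suc] by (simp)
qed (use assms in simp)

lemma pderivs_root:
  assumes "[:- z, 1:] ^ m dvd P" "r < m" shows "poly (pderivs r P) z = 0"
proof -
  have "[:- z, 1:] ^ 1 dvd [:- z, 1:] ^ (m - r)" using assms(2) by (intro le_imp_power_dvd) simp
  with root_power_dvd_pderivs[OF assms(1), of r] have "[:- z, 1:] dvd pderivs r P"
    by (metis dvd_trans power_one_right)
  then show ?thesis by (simp add: poly_eq_0_iff_dvd)
qed

lemma pderivs_power_self: "pderivs q ([:- z, 1:] ^ q) = [:fact q:]"
proof (induction q)
  case (Suc q)
  have "pderiv ([:- z, 1:] ^ Suc q) = smult (of_nat (Suc q)) ([:- z, 1:] ^ q)"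
    unfolding pderiv_power_Suc by (simp add: pderiv_pCons)
  then have "pderivs (Suc q) ([:- z, 1:] ^ Suc q) = smult (of_nat (Suc q)) (pderivs q ([:- z, 1:] ^ q))"
    by (simp add: funpow_Suc_right pderivs_linear del: funpow.simps power.simps)
  then show ?case using Suc by simp
qed (simp add: one_pCons)

text \<open>The pairing, up to its normalisation, as a polynomial in the base point: independence of
  the base point becomes a vanishing derivative, and the alternating signs make this derivative
  telescope.\<close>

definition wron :: "nat \<Rightarrow> real poly \<Rightarrow> real poly \<Rightarrow> real poly" where
  "wron q P Q = (\<Sum>r\<le>q. smult ((-1) ^ r) (pderivs r P * pderivs (q - r) Q))"

text \<open>The base point 0 is arbitrary when both degrees are at most \<open>q\<close>, see
  \<open>dual_at\<close>. Dividing by \<open>fact q\<close> makes the pairing with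
  \<open>(y - x)^q\<close> the evaluation at \<open>x\<close>.\<close>

definition dual :: "nat \<Rightarrow> real poly \<Rightarrow> real poly \<Rightarrow> real" where
  "dual q P Q = poly (wron q P Q) 0 / fact q"

lemma pderiv_wron:
  assumes "degree P \<le> q" "degree Q \<le> q" shows "pderiv (wron q P Q) = 0"
proof -
  \<comment> \<open>The derivative of each term is a difference of consecutive \<open>h\<close>; the
    two values that survive contain a derivative of order \<open>q+1\<close> of \<open>Q\<close> or
    of \<open>P\<close>.\<close>
  define h where "h r = smult ((-1) ^ r) (pderivs r P * pderivs (Suc q - r) Q)" for r
  have "pderiv (wron q P Q) = (\<Sum>r\<le>q. h r - h (Suc r))"
    unfolding wron_def h_def
    by (subst higher_pderiv_sum[of 1, simplified], intro sum.cong)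
       (simp_all add: pderiv_smult pderiv_mult Suc_diff_le smult_add_right algebra_simps)
  also have "\<dots> = h 0 - h (Suc q)"
    by (rule sum_telescope)
  also have "\<dots> = 0"
    unfolding h_def using assms
    by (simp add: pderivs_eq_0 del: funpow.simps)
  finally show ?thesis .
qed

lemma dual_at:
  assumes "degree P \<le> q" "degree Q \<le> q"
  shows "dual q P Q = (\<Sum>r\<le>q. (-1) ^ r * poly (pderivs r P) z * poly (pderivs (q - r) Q) z) / fact q"
proof -
  from pderiv_wron[OF assms] have "degree (wron q P Q) = 0" by (simp add: pderiv_eq_0_iff)
  then obtain c where "wron q P Q = [:c:]" by (metis degree_eq_zeroE)
  then have "poly (wron q P Q) 0 = poly (wron q P Q) z" by simp
  then show ?thesis by (simp add: dual_def wron_def poly_sum algebra_simps)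
qed

lemma dual_linear:
  "dual q (P + P') Q = dual q P Q + dual q P' Q"
  "dual q (P - P') Q = dual q P Q - dual q P' Q"
  "dual q P (Q + Q') = dual q P Q + dual q P Q'"
  "dual q (smult c P) Q = c * dual q P Q"
  "dual q P (smult c Q) = c * dual q P Q"
  "dual q 0 Q = 0" "dual q P 0 = 0"
  by (simp_all add: dual_def wron_def pderivs_linear poly_sum sum.distrib sum_subtractf sum_distrib_left
      add_divide_distrib diff_divide_distrib algebra_simps)

lemma dual_sum:
  fixes P R :: "'a \<Rightarrow> real poly" and P' Q' :: "real poly"
  shows "dual q (\<Sum>i\<in>I. P i) Q' = (\<Sum>i\<in>I. dual q (P i) Q')"
    "dual q P' (\<Sum>i\<in>I. R i) = (\<Sum>i\<in>I. dual q P' (R i))"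
  by (induction I rule: infinite_finite_induct) (simp_all add: dual_linear)

lemma degree_root_power: "degree ([:- z, 1:] ^ q :: real poly) \<le> q"
  by (metis degree_linear_power order_refl)

text \<open>With base point \<open>x\<close> only the term \<open>r = 0\<close> remains: all others
  contain a derivative of the power of order below \<open>q\<close>.\<close>

lemma dual_power_right:
  assumes "degree P \<le> q" shows "dual q P ([:- x, 1:] ^ q) = poly P x"
proof -
  have "dual q P ([:- x, 1:] ^ q) =
     (\<Sum>r\<le>q. (-1) ^ r * poly (pderivs r P) x * poly (pderivs (q - r) ([:- x, 1:] ^ q)) x) / fact q"
    by (rule dual_at[OF assms degree_root_power])
  also have "(\<Sum>r\<le>q. (-1) ^ r * poly (pderivs r P) x * poly (pderivs (q - r) ([:- x, 1:] ^ q)) x) =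
      (\<Sum>r\<in>{0}. (-1) ^ r * poly (pderivs r P) x * poly (pderivs (q - r) ([:- x, 1:] ^ q)) x)"
    by (rule sum.mono_neutral_right) (auto simp: pderivs_root[OF dvd_refl])
  finally show ?thesis by (simp add: pderivs_power_self)
qed

lemma dual_power_left:
  assumes "degree Q \<le> q" shows "dual q ([:- x, 1:] ^ q) Q = (-1) ^ q * poly Q x"
proof -
  have "dual q ([:- x, 1:] ^ q) Q =
     (\<Sum>r\<le>q. (-1) ^ r * poly (pderivs r ([:- x, 1:] ^ q)) x * poly (pderivs (q - r) Q) x) / fact q"
    by (rule dual_at[OF degree_root_power assms])
  also have "(\<Sum>r\<le>q. (-1) ^ r * poly (pderivs r ([:- x, 1:] ^ q)) x * poly (pderivs (q - r) Q) x) =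
      (\<Sum>r\<in>{q}. (-1) ^ r * poly (pderivs r ([:- x, 1:] ^ q)) x * poly (pderivs (q - r) Q) x)"
    by (rule sum.mono_neutral_right) (auto simp: pderivs_root[OF dvd_refl])
  finally show ?thesis by (simp add: pderivs_power_self)
qed

text \<open>As \<open>degree Q \<le> q\<close>, the first term of the pairing of degree
  \<open>q+1\<close> vanishes. Shifting the index gives the sign, the quotient of the factorials
  gives the factor.\<close>

lemma dual_pderiv:
  assumes "degree P \<le> Suc q" "degree Q \<le> q"
  shows "dual q (pderiv P) Q = - real (Suc q) * dual (Suc q) P Q"
proof -
  have "pderivs (Suc q) Q = 0" using assms(2) by (intro pderivs_eq_0) simp
  then have "wron (Suc q) P Q = - wron q (pderiv P) Q"
    unfolding wron_def
    by (subst sum.atMost_Suc_shift) (simp add: sum_negf funpow_Suc_right del: funpow.simps)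
  then show ?thesis by (simp add: dual_def fact_Suc del: of_nat_Suc)
qed

theorem bpoly_expansion:
  assumes t: "mono t" "t k < t (Suc k)" and q: "q \<le> k" and P: "degree P \<le> q"
  shows "P = (\<Sum>i=k-q..k. smult (dual q P (psi t q i)) (bpoly t k q i))"
proof (rule poly_ext)
  fix x
  \<comment> \<open>Marsden's identity for fixed \<open>x\<close>, read as an identity between
    polynomials in \<open>y\<close>.\<close>
  have "[:- x, 1:] ^ q = (\<Sum>i=k-q..k. smult (poly (bpoly t k q i) x) (psi t q i))"
    by (rule poly_ext) (use marsden[OF t q, of _ x] in \<open>simp add: poly_sum poly_power mult.commute\<close>)
  then have "poly P x = dual q P (\<Sum>i=k-q..k. smult (poly (bpoly t k q i) x) (psi t q i))"
    using dual_power_right[OF P, of x] by simp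
  then show "poly P x = poly (\<Sum>i=k-q..k. smult (dual q P (psi t q i)) (bpoly t k q i)) x"
    by (simp add: dual_sum dual_linear poly_sum mult.commute)
qed

text \<open>Strong induction downwards from index \<open>k\<close>. Once the coefficients above
  \<open>j\<close> are zero, all remaining products share the factor \<open>M\<close> of the knots
  \<open>j+1\<close> to \<open>k\<close>. It has to be divided out first, since these knots may
  equal \<open>t j\<close>; then evaluation at \<open>t j\<close> kills every summand except the one
  of index \<open>j\<close>, whose roots are all at least \<open>t (Suc k) > t j\<close>.\<close>

lemma psi_independent:
  assumes t: "mono t" "t k < t (Suc k)" and q: "q \<le> k"
    and 0: "(\<Sum>i=k-q..k. smult (a i) (psi t q i)) = 0" and "d \<le> q"
  shows "a (k - d) = 0"
  using \<open>d \<le> q\<close>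
proof (induction d rule: less_induct)
  case (less d)
  define j where "j = k - d"
  have j: "j \<in> {k-q..k}" "k - j = d" using less.prems q by (auto simp: j_def)
  define M where "M = (\<Prod>l\<in>{j+1..k}. [:- t l, 1:])"
  define R where "R i = (\<Prod>l\<in>{i+1..j} \<union> {k+1..i+q}. [:- t l, 1:])" for i
  have psi: "psi t q i = M * R i" if "i \<in> {k-q..j}" for i
  proof -
    have "{i+1..i+q} = {j+1..k} \<union> ({i+1..j} \<union> {k+1..i+q})" using that j(1) by auto
    then show ?thesis unfolding psi_def M_def R_def
      by (simp only:) (rule prod.union_disjoint; use j(1) in auto)
  qed
  have a0: "a i = 0" if "i \<in> {k-q..k} - {k-q..j}" for i
  proof -
    have "a (k - (k - i)) = 0" using that j by (intro less.IH) auto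
    then show ?thesis using that by simp
  qed
  have "0 = (\<Sum>i=k-q..j. smult (a i) (psi t q i))"
    unfolding 0[symmetric] by (rule sum.mono_neutral_right) (use j a0 in auto)
  also have "\<dots> = M * (\<Sum>i=k-q..j. smult (a i) (R i))"
    by (simp add: sum_distrib_left psi)
  finally have "(\<Sum>i=k-q..j. smult (a i) (R i)) = 0"
    by (auto simp: M_def)
  then have "0 = poly (\<Sum>i=k-q..j. smult (a i) (R i)) (t j)" by simp
  also have "\<dots> = (\<Sum>i=k-q..j. a i * poly (R i) (t j))" by (simp add: poly_sum)
  also have "\<dots> = (\<Sum>i\<in>{j}. a i * poly (R i) (t j))"
    by (rule sum.mono_neutral_right) (use j in \<open>auto simp: R_def poly_prod\<close>)
  finally have "a j * poly (R j) (t j) = 0" by simp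
  moreover have "t j \<noteq> t l" if "l \<in> {k+1..j+q}" for l
  proof -
    have "t j \<le> t k" "t (Suc k) \<le> t l" using that j by (auto intro!: monoD[OF t(1)])
    with t(2) show ?thesis by simp
  qed
  then have "poly (R j) (t j) \<noteq> 0" by (auto simp: R_def poly_prod)
  ultimately show ?case by (simp add: j_def)
qed

text \<open>Now Marsden's identity is read as a polynomial identity in \<open>x\<close> for fixed
  \<open>y\<close> and paired with \<open>psi t q j\<close>. This expands \<open>psi t q j\<close>
  in the \<open>psi t q l\<close> with the wanted numbers as coefficients, and independence leaves
  only the Kronecker delta.\<close>

theorem dual_bpoly:
  assumes t: "mono t" "t k < t (Suc k)" and q: "q \<le> k"
    and i: "i \<in> {k-q..k}" and j: "j \<in> {k-q..k}"
  shows "dual q (bpoly t k q i) (psi t q j) = (if i = j then 1 else 0)"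
proof -
  define a where "a l = dual q (bpoly t k q l) (psi t q j) - (if l = j then 1 else 0)" for l
  have "(\<Sum>l=k-q..k. smult (a l) (psi t q l)) = 0"
  proof (rule poly_ext)
    fix y
    have "(\<Sum>l=k-q..k. smult (poly (psi t q l) y) (bpoly t k q l)) = smult ((-1) ^ q) ([:- y, 1:] ^ q)"
    proof (rule poly_ext)
      fix x
      have "poly (\<Sum>l=k-q..k. smult (poly (psi t q l) y) (bpoly t k q l)) x = (y - x) ^ q"
        using marsden[OF t q, of y x] by (simp add: poly_sum)
      also have "\<dots> = (-1) ^ q * (x - y) ^ q"
        by (metis minus_diff_eq mult_minus1 power_mult_distrib)
      finally show "poly (\<Sum>l=k-q..k. smult (poly (psi t q l) y) (bpoly t k q l)) x =
         poly (smult ((-1) ^ q) ([:- y, 1:] ^ q)) x" by (simp add: poly_power)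
    qed
    from arg_cong[OF this, of "\<lambda>P. dual q P (psi t q j)"]
    have "(\<Sum>l=k-q..k. poly (psi t q l) y * dual q (bpoly t k q l) (psi t q j)) = poly (psi t q j) y"
      by (simp add: dual_sum dual_linear dual_power_left degree_psi flip: power_mult_distrib mult.assoc)
    moreover have "(\<Sum>l=k-q..k. poly (psi t q l) y * (if l = j then 1 else 0)) = poly (psi t q j) y"
      using j by (simp add: if_distrib cong: if_cong)
    ultimately show "poly (\<Sum>l=k-q..k. smult (a l) (psi t q l)) y = poly 0 y"
      by (simp add: a_def poly_sum algebra_simps sum_subtractf)
  qed
  from psi_independent[OF t q this, of "k - i"] i have "a i = 0" by auto
  then show ?thesis by (simp add: a_def split: if_splits)
qed

section \<open>Polynomial pieces of a spline: coefficients, derivatives, smoothness\<close>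

definition spoly :: "(nat \<Rightarrow> real) \<Rightarrow> nat \<Rightarrow> (nat \<Rightarrow> real) \<Rightarrow> nat \<Rightarrow> real poly" where
  "spoly t q c k = (\<Sum>i=k-q..k. smult (c i) (bpoly t k q i))"

lemma degree_spoly: "degree (spoly t q c k) \<le> q"
  unfolding spoly_def
  by (intro degree_sum_le) (auto intro!: order_trans[OF degree_smult_le] degree_bpoly)

lemma dual_spoly:
  assumes "mono t" "t k < t (Suc k)" "q \<le> k" "j \<in> {k-q..k}"
  shows "dual q (spoly t q c k) (psi t q j) = c j"
proof -
  have "dual q (spoly t q c k) (psi t q j) = (\<Sum>i=k-q..k. c i * (if i = j then 1 else 0))"
    unfolding spoly_def dual_sum
    by (intro sum.cong refl) (simp add: dual_linear dual_bpoly[OF assms(1-3) _ assms(4)])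
  then show ?thesis using assms(4) by (simp add: if_distrib cong: if_cong)
qed

lemma spoly_dual:
  assumes "mono t" "t k < t (Suc k)" "q \<le> k" "degree P \<le> q"
    and "\<And>i. i \<in> {k-q..k} \<Longrightarrow> c i = dual q P (psi t q i)"
  shows "spoly t q c k = P"
  unfolding spoly_def
  by (rule trans[OF _ bpoly_expansion[OF assms(1-4), symmetric]]) (simp add: assms(5))

lemma psi_diff:
  assumes "i > 0"
  shows "psi t (Suc q) i - psi t (Suc q) (i-1) = smult (t i - t (i+q+1)) (psi t q i)"
proof -
  have 1: "psi t (Suc q) i = psi t q i * [:- t (i+q+1), 1:]"
    by (simp add: psi_def)
  have "psi t (Suc q) (i-1) = (\<Prod>l\<in>{i..i+q}. [:- t l, 1:])"
    using assms by (simp add: psi_def)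
  also have "\<dots> = [:- t i, 1:] * psi t q i"
    by (subst prod.atLeast_Suc_atMost) (simp_all add: psi_def)
  finally have 2: "psi t (Suc q) (i-1) = [:- t i, 1:] * psi t q i" .
  show ?thesis unfolding 1 2 by (intro poly_ext) (simp add: algebra_simps)
qed

text \<open>By duality only pairings of the derivative are needed. \<open>dual_pderiv\<close> moves
  them to the piece itself, and \<open>psi_diff\<close> turns \<open>psi t q i\<close> into a
  multiple of a difference of neighbours, whose pairings are \<open>c i\<close> and
  \<open>c (i-1)\<close>.\<close>

lemma pderiv_spoly:
  assumes t: "mono t" "t k < t (Suc k)" and q: "Suc q \<le> k"
  shows "pderiv (spoly t (Suc q) c k) =
    spoly t q (\<lambda>i. real (Suc q) * (c i - c (i-1)) / (t (i+q+1) - t i)) k"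
proof (rule sym, rule spoly_dual[OF t])
  let ?P = "spoly t (Suc q) c k"
  show "degree (pderiv ?P) \<le> q" using degree_spoly[of t "Suc q" c k] by (simp add: degree_pderiv)
  fix i assume i: "i \<in> {k-q..k}"
  then have i0: "i > 0" and "i \<in> {k-Suc q..k}" "i-1 \<in> {k-Suc q..k}" using q by auto
  then have "c i - c (i-1) = dual (Suc q) ?P (psi t (Suc q) i) - dual (Suc q) ?P (psi t (Suc q) (i-1))"
    using dual_spoly[OF t q] by simp
  also have "\<dots> = dual (Suc q) ?P (psi t (Suc q) i - psi t (Suc q) (i-1))"
    using dual_linear(3)[of "Suc q" ?P "psi t (Suc q) i - psi t (Suc q) (i-1)" "psi t (Suc q) (i-1)"]
    by simp
  also have "\<dots> = (t i - t (i+q+1)) * dual (Suc q) ?P (psi t q i)"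
    unfolding psi_diff[OF i0] by (simp add: dual_linear)
  finally have *: "c i - c (i-1) = (t i - t (i+q+1)) * dual (Suc q) ?P (psi t q i)" .
  have "t i \<le> t k" "t (Suc k) \<le> t (i+q+1)" using i by (auto intro!: monoD[OF t(1)])
  with t(2) have "t i < t (i+q+1)" by simp
  then show "real (Suc q) * (c i - c (i-1)) / (t (i+q+1) - t i) = dual q (pderiv ?P) (psi t q i)"
    unfolding dual_pderiv[OF degree_spoly degree_psi] * by (simp add: field_simps)
qed (use q in simp)

text \<open>If at least \<open>q\<close> knots coincide at \<open>z\<close>, a single piece of
  degree \<open>q\<close> survives there. This and its mirror image for the interval starting at
  \<open>z\<close> are the base case of \<open>bpoly_continuous\<close>.\<close>

lemma bpoly_at_right_end:
  assumes t: "mono t" "t k < z" and z: "\<And>l. l \<in> {k+1..k'} \<Longrightarrow> t l = z" and "k + q \<le> k'"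
  shows "poly (bpoly t k q i) z = (if i = k then 1 else 0)"
  using assms(4)
proof (induction q arbitrary: i)
  case (Suc q)
  then have "t (k+q+1) = z" using z by simp
  then show ?case unfolding poly_bpoly_Suc using Suc t(2) by auto
qed simp

lemma bpoly_at_left_end:
  assumes t: "mono t" "z < t (Suc k')" and z: "\<And>l. l \<in> {k+1..k'} \<Longrightarrow> t l = z" and "k + q \<le> k'"
  shows "poly (bpoly t k' q i) z = (if i + q = k' then 1 else 0)"
  using assms(4)
proof (induction q arbitrary: i)
  case (Suc q)
  have 1: "z = t i" if "i + q = k'" using that z Suc.prems by simp
  have 2: "(t (i+q+2) - z) / (t (i+q+2) - t (i+1)) = 1" if "i + 1 + q = k'"
  proof -
    have "t (i+1) = z" using that z Suc.prems by simp
    moreover have "t (i+q+2) = t (Suc k')" using that by (intro arg_cong[of _ _ t]) simp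
    ultimately show ?thesis using t(2) by simp
  qed
  show ?case unfolding poly_bpoly_Suc using Suc 1 2 by auto
qed simp

text \<open>At degree \<open>k' - k\<close>, the multiplicity of \<open>z\<close>, both sides are
  the indicator of \<open>i = k\<close>. Above this degree the recursion uses the same weights on
  both intervals, so equality is inherited.\<close>

lemma bpoly_continuous:
  assumes t: "mono t" "t k < z" "z < t (Suc k')" and z: "\<And>l. l \<in> {k+1..k'} \<Longrightarrow> t l = z"
    and "k \<le> k'" "k' \<le> k + q"
  shows "poly (bpoly t k q i) z = poly (bpoly t k' q i) z"
proof -
  define m where "m = k' - k"
  have km: "k' = k + m" using assms by (simp add: m_def)
  have *: "poly (bpoly t k (m + d) i) z = poly (bpoly t k' (m + d) i) z" for d i
  proof (induction d arbitrary: i)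
    case 0
    then show ?case using bpoly_at_right_end[where k'=k' and q=m and i=i, OF t(1,2) z]
        bpoly_at_left_end[where k=k and q=m and i=i, OF t(1,3) z]
      by (simp add: km)
  next
    case (Suc d)
    then show ?case unfolding add_Suc_right poly_bpoly_Suc by simp
  qed
  show ?thesis using *[of "q - m"] assms by (simp add: km)
qed

text \<open>Differentiation lowers the degree by one and keeps the knots, so the bound on
  \<open>r\<close>, degree minus multiplicity, allows an induction down to plain continuity of all
  B-splines that touch one of the two intervals.\<close>

theorem spoly_smooth:
  assumes t: "mono t" "t k < z" "z < t (Suc k')" and z: "\<And>l. l \<in> {k+1..k'} \<Longrightarrow> t l = z"
    and "k < k'" and "q \<le> k" "k' + r \<le> k + q"
  shows "poly (pderivs r (spoly t q c k)) z = poly (pderivs r (spoly t q c k')) z"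
  using assms(6,7)
proof (induction r arbitrary: q c)
  case 0
  have "poly (spoly t q c k) z = (\<Sum>i=k-q..k'. c i * poly (bpoly t k q i) z)"
    unfolding spoly_def poly_sum poly_smult
    by (rule sum.mono_neutral_left) (use \<open>k < k'\<close> in \<open>auto simp: bpoly_eq_0\<close>)
  also have "\<dots> = (\<Sum>i=k-q..k'. c i * poly (bpoly t k' q i) z)"
    using bpoly_continuous[OF t z] 0 \<open>k < k'\<close> by simp
  also have "\<dots> = poly (spoly t q c k') z"
    unfolding spoly_def poly_sum poly_smult
    by (rule sum.mono_neutral_right) (use \<open>k < k'\<close> in \<open>auto simp: bpoly_eq_0\<close>)
  finally show ?case by simp
next
  case (Suc r)
  then obtain q' where q': "q = Suc q'" using \<open>k < k'\<close> by (cases q) auto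
  have k: "t k < t (Suc k)" "t k' < t (Suc k')" using t z \<open>k < k'\<close> by auto
  show ?case
    unfolding q' funpow_Suc_right o_apply using Suc.prems \<open>k < k'\<close> q'
    by (subst (1 2) pderiv_spoly[OF t(1)]) (auto simp: k intro!: Suc.IH)
qed

section \<open>Knot vectors and splines\<close>

lemma higher_deriv_poly:
  fixes f :: "real \<Rightarrow> real"
  assumes "open S" "\<And>y. y \<in> S \<Longrightarrow> f y = poly P y" "x \<in> S"
  shows "(deriv ^^ r) f x = poly (pderivs r P) x"
    and "((deriv ^^ r) f has_field_derivative poly (pderivs (Suc r) P) x) (at x)"
proof -
  have *: "(deriv ^^ r) f x = poly (pderivs r P) x \<and>
      ((deriv ^^ r) f has_field_derivative poly (pderivs (Suc r) P) x) (at x)"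
    using assms(3)
  proof (induction r arbitrary: x)
    case 0
    have "(f has_field_derivative poly (pderiv P) x) (at x)"
      by (rule has_field_derivative_transform_within_open[OF poly_DERIV assms(1) 0])
         (simp add: assms(2))
    then show ?case using assms(2) 0 by simp
  next
    case (Suc r)
    have eq: "(deriv ^^ Suc r) f y = poly (pderivs (Suc r) P) y" if "y \<in> S" for y
      using Suc.IH[OF that] by (auto intro: DERIV_imp_deriv)
    have "((deriv ^^ Suc r) f has_field_derivative poly (pderiv (pderivs (Suc r) P)) x) (at x)"
      by (rule has_field_derivative_transform_within_open[OF poly_DERIV assms(1) Suc.prems])
         (simp only: eq)
    then show ?case using eq[OF Suc.prems] by simp
  qed
  then show "(deriv ^^ r) f x = poly (pderivs r P) x"
    and "((deriv ^^ r) f has_field_derivative poly (pderivs (Suc r) P) x) (at x)" by blast+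
qed

lemma tendsto_at_left_transform:
  fixes g :: "real \<Rightarrow> real"
  assumes "u < z" "\<And>y. y \<in> {u<..<z} \<Longrightarrow> g y = h y" "(h \<longlongrightarrow> L) (at z)"
  shows "(g \<longlongrightarrow> L) (at_left z)"
proof (rule Lim_transform_eventually)
  show "(h \<longlongrightarrow> L) (at_left z)" using assms(3) by (simp add: filterlim_at_split)
  show "\<forall>\<^sub>F x in at_left z. h x = g x"
    using assms by (intro eventually_at_leftI[of u]) auto
qed

lemma tendsto_at_right_transform:
  fixes g :: "real \<Rightarrow> real"
  assumes "z < v" "\<And>y. y \<in> {z<..<v} \<Longrightarrow> g y = h y" "(h \<longlongrightarrow> L) (at z)"
  shows "(g \<longlongrightarrow> L) (at_right z)"
proof (rule Lim_transform_eventually)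
  show "(h \<longlongrightarrow> L) (at_right z)" using assms(3) by (simp add: filterlim_at_split)
  show "\<forall>\<^sub>F x in at_right z. h x = g x"
    using assms by (intro eventually_at_rightI[of _ v]) auto
qed

lemma poly_tendsto_at: "((\<lambda>x. poly P x) \<longlongrightarrow> poly P z) (at (z::real))"
  using poly_isCont isCont_def by blast

text \<open>By continuity both one-sided limits of the \<open>r\<close>-th derivative are its value
  at \<open>z\<close>, and on each open side it is the derivative of the polynomial there.\<close>

lemma has_cont_derivs_at_matching:
  assumes "u < z" "z < v" "\<And>y. y \<in> {u<..<z} \<Longrightarrow> f y = poly P y"
    "\<And>y. y \<in> {z..<v} \<Longrightarrow> f y = poly Q y"
    and "has_cont_derivs_at k f z" "r \<le> k"
  shows "poly (pderivs r P) z = poly (pderivs r Q) z"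
proof -
  have c: "((deriv ^^ r) f \<longlongrightarrow> (deriv ^^ r) f z) (at z)"
    using assms(5,6) by (auto simp: has_cont_derivs_at_def isCont_def)
  have "((deriv ^^ r) f \<longlongrightarrow> poly (pderivs r P) z) (at_left z)"
    by (rule tendsto_at_left_transform[OF assms(1) _ poly_tendsto_at])
       (rule higher_deriv_poly(1)[of "{u<..<z}"], use assms(3) in auto)
  with c have 1: "poly (pderivs r P) z = (deriv ^^ r) f z"
    by (auto simp: filterlim_at_split intro: tendsto_unique[OF trivial_limit_at_left_real])
  have "((deriv ^^ r) f \<longlongrightarrow> poly (pderivs r Q) z) (at_right z)"
    by (rule tendsto_at_right_transform[OF assms(2) _ poly_tendsto_at])
       (rule higher_deriv_poly(1)[of "{z<..<v}"], use assms(4) in auto)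
  with c have 2: "poly (pderivs r Q) z = (deriv ^^ r) f z"
    by (auto simp: filterlim_at_split intro: tendsto_unique[OF trivial_limit_at_right_real])
  show ?thesis using 1 2 by simp
qed

lemma has_derivative_matching:
  fixes g :: "real \<Rightarrow> real"
  assumes "u < z" "z < v" "\<And>y. y \<in> {u<..<z} \<Longrightarrow> g y = poly P y"
    "\<And>y. y \<in> {z..<v} \<Longrightarrow> g y = poly Q y"
    and "poly P z = poly Q z" "poly (pderiv P) z = poly (pderiv Q) z"
  shows "(g has_field_derivative poly (pderiv Q) z) (at z)"
  unfolding has_field_derivative_iff
proof (rule filterlim_split_at)
  have gz: "g z = poly P z" "g z = poly Q z" using assms by auto
  have "((\<lambda>y. (poly P y - poly P z) / (y - z)) \<longlongrightarrow> poly (pderiv Q) z) (at z)"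
    using poly_DERIV[of P z] by (simp add: has_field_derivative_iff assms(6))
  then show "((\<lambda>y. (g y - g z) / (y - z)) \<longlongrightarrow> poly (pderiv Q) z) (at_left z)"
    by (rule tendsto_at_left_transform[OF assms(1), rotated]) (simp add: assms(3) gz(1))
  have "((\<lambda>y. (poly Q y - poly Q z) / (y - z)) \<longlongrightarrow> poly (pderiv Q) z) (at z)"
    using poly_DERIV[of Q z] by (simp add: has_field_derivative_iff)
  then show "((\<lambda>y. (g y - g z) / (y - z)) \<longlongrightarrow> poly (pderiv Q) z) (at_right z)"
    by (rule tendsto_at_right_transform[OF assms(2), rotated]) (simp add: assms(4) gz(2))
qed

lemma has_cont_derivs_atI:
  assumes uv: "u < z" "z < v" and P: "\<And>y. y \<in> {u<..<z} \<Longrightarrow> f y = poly P y"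
    and Q: "\<And>y. y \<in> {z..<v} \<Longrightarrow> f y = poly Q y"
    and match: "\<And>r. r \<le> k \<Longrightarrow> poly (pderivs r P) z = poly (pderivs r Q) z"
  shows "has_cont_derivs_at k f z"
proof -
  have l: "(deriv ^^ r) f y = poly (pderivs r P) y" if "y \<in> {u<..<z}" for r y
    by (rule higher_deriv_poly(1)[of "{u<..<z}"]) (use P that in auto)
  have r': "(deriv ^^ r) f y = poly (pderivs r Q) y" if "y \<in> {z<..<v}" for r y
    by (rule higher_deriv_poly(1)[of "{z<..<v}"]) (use Q that in auto)
  \<comment> \<open>The point \<open>z\<close> itself needs an induction: the next derivative at
    \<open>z\<close> is a difference quotient limit that involves the value of the previous one at
    \<open>z\<close>.\<close>
  have "r \<le> k \<Longrightarrow> (deriv ^^ r) f z = poly (pderivs r Q) z" for r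
  proof (induction r)
    case 0
    then show ?case using Q uv by simp
  next
    case (Suc r)
    then have "(deriv ^^ r) f y = poly (pderivs r Q) y" if "y \<in> {z..<v}" for y
      using r' that by (cases "y = z") auto
    then have "((deriv ^^ r) f has_field_derivative poly (pderiv (pderivs r Q)) z) (at z)"
      by (intro has_derivative_matching[OF uv l])
         (use Suc.prems match[of r] match[of "Suc r"] in auto)
    then show ?case by (simp add: DERIV_imp_deriv)
  qed
  with r' have r: "(deriv ^^ r) f y = poly (pderivs r Q) y" if "r \<le> k" "y \<in> {z..<v}" for r y
    using that by (cases "y = z") auto
  have "(deriv ^^ r) f differentiable (at y)" if "r < k" "y \<in> {u<..<v}" for r y
  proof -
    consider "y \<in> {u<..<z}" | "y \<in> {z<..<v}" | "y = z" using \<open>y \<in> {u<..<v}\<close> by force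
    then show ?thesis
    proof cases
      case 1
      with higher_deriv_poly(2)[of "{u<..<z}" f P y r] P show ?thesis
        by (auto simp: real_differentiable_def)
    next
      case 2
      with higher_deriv_poly(2)[of "{z<..<v}" f Q y r] Q show ?thesis
        by (auto simp: real_differentiable_def)
    next
      case 3
      have "((deriv ^^ r) f has_field_derivative poly (pderiv (pderivs r Q)) z) (at z)"
        by (rule has_derivative_matching[OF uv l])
           (use r that match[of r] match[of "Suc r"] in auto)
      then show ?thesis using 3 by (auto simp: real_differentiable_def)
    qed
  qed
  moreover have "\<forall>\<^sub>F y in nhds z. y \<in> {u<..<v}"
    using uv by (intro eventually_nhds_in_open) auto
  ultimately have 1: "\<forall>\<^sub>F y in nhds z. (deriv ^^ r) f differentiable (at y)" if "r < k" for r
    using that by (auto elim: eventually_mono)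
  have "isCont ((deriv ^^ r) f) z" if "r \<le> k" for r
    unfolding isCont_def
  proof (rule filterlim_split_at)
    have z: "(deriv ^^ r) f z = poly (pderivs r Q) z" using r that uv by simp
    show "((deriv ^^ r) f \<longlongrightarrow> (deriv ^^ r) f z) (at_left z)"
      unfolding z match[OF that, symmetric]
      by (rule tendsto_at_left_transform[OF uv(1) _ poly_tendsto_at]) (use l in auto)
    show "((deriv ^^ r) f \<longlongrightarrow> (deriv ^^ r) f z) (at_right z)"
      unfolding z
      by (rule tendsto_at_right_transform[OF uv(2) _ poly_tendsto_at]) (use r that in auto)
  qed
  with 1 show ?thesis by (simp add: has_cont_derivs_at_def)
qed

section \<open>Knot vectors, their pieces and breakpoints\<close>

lemma bpoly_outside: "i \<notin> {k-q..k} \<Longrightarrow> bpoly t k q i = 0"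
  by (intro bpoly_eq_0) auto

text \<open>Clamping the index makes the knots a monotone function on all naturals, as the results
  on polynomial pieces assume; index 0 repeats the first knot.\<close>

definition knot :: "real list \<Rightarrow> nat \<Rightarrow> real" where
  "knot \<Xi> i = \<Xi> ! (min i (length \<Xi>) - 1)"

lemma knot_eq: "i \<le> length \<Xi> \<Longrightarrow> knot \<Xi> i = \<Xi>\<langle>i\<rangle>"
  by (simp add: knot_def min_def)

text \<open>An intrinsic form of a basic knot vector: the interior knots are strictly separated from
  both ends, and no \<open>p+2\<close> consecutive knots coincide.\<close>

locale knot_vector =
  fixes p :: nat and \<Xi> :: "real list"
  assumes sorted: "sorted \<Xi>" and len: "2 * p + 2 \<le> length \<Xi>"
    and left_end: "knot \<Xi> (p + 1) < knot \<Xi> (p + 2)"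
    and right_end: "knot \<Xi> (spline_dim p \<Xi>) < knot \<Xi> (spline_dim p \<Xi> + 1)"
    and mult: "\<And>i. i \<in> {1..spline_dim p \<Xi>} \<Longrightarrow> knot \<Xi> i < knot \<Xi> (i + p + 1)"
begin

abbreviation t where "t \<equiv> knot \<Xi>"
abbreviation n where "n \<equiv> spline_dim p \<Xi>"

lemma n: "n + p + 1 = length \<Xi>" "p + 1 \<le> n"
  using len by (simp_all add: spline_dim_def)

lemma mono_t: "mono t"
proof (rule monoI)
  fix i j :: nat assume "i \<le> j"
  then show "t i \<le> t j"
    unfolding knot_def using len by (intro sorted_nth_mono[OF sorted]) auto
qed

definition in_piece :: "nat \<Rightarrow> real \<Rightarrow> bool" where
  "in_piece k x \<longleftrightarrow> k \<in> {p+1..n} \<and> t k \<le> x \<and> (x < t (k+1) \<or> k = n \<and> x = t (n+1))"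

lemma in_pieceD:
  assumes "in_piece k x"
  shows "k \<in> {p+1..n}" "t k < t (Suc k)" "t k \<le> x" "x \<le> t (Suc k)" "p \<le> k"
  using assms right_end by (auto simp: in_piece_def)

lemma in_piece_ends:
  assumes "in_piece k x" shows "x \<in> {t (p+1)..t (n+1)}"
  using in_pieceD[OF assms] monoD[OF mono_t, of "p+1" k] monoD[OF mono_t, of "Suc k" "n+1"] by auto

lemma ex_in_piece:
  assumes "x \<in> {t (p+1)..t (n+1)}" shows "\<exists>k. in_piece k x"
proof (cases "x = t (n+1)")
  case True
  then show ?thesis using right_end n by (intro exI[of _ n]) (auto simp: in_piece_def)
next
  case False
  with assms have x: "t (p+1) \<le> x" "x < t (n+1)" by auto
  define k where "k = Max {i\<in>{p+1..n}. t i \<le> x}"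
  have k: "k \<in> {i\<in>{p+1..n}. t i \<le> x}"
    unfolding k_def by (rule Max_in) (use x n in auto)
  have "x < t (k+1)"
  proof (rule ccontr)
    assume "\<not> x < t (k+1)"
    then have "t (k+1) \<le> x" by simp
    moreover from this x have "k + 1 \<noteq> n + 1" by (metis not_le)
    ultimately have "k + 1 \<in> {i\<in>{p+1..n}. t i \<le> x}" using k by auto
    then have "k + 1 \<le> k" unfolding k_def by (intro Max_ge) auto
    then show False by simp
  qed
  with k show ?thesis by (auto simp: in_piece_def)
qed

text \<open>The bound on \<open>i + q + 1\<close> keeps every knot of the recursion inside the list,
  where \<open>knot\<close> is not clamped. At the right end the left-limit convention selects
  interval \<open>n\<close>.\<close>

lemma cox_de_boor_eq:
  assumes "in_piece k x" "i + q + 1 \<le> length \<Xi>"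
  shows "cox_de_boor \<Xi> (t (n+1)) q i x = poly (bpoly t k q i) x"
  using assms(2)
proof (induction q arbitrary: i)
  case 0
  have k: "k \<le> n" using in_pieceD[OF assms(1)] by auto
  have e: "\<Xi>\<langle>i\<rangle> = t i" "\<Xi>\<langle>i+1\<rangle> = t (Suc i)" using 0 by (simp_all add: knot_eq)
  show ?case
  proof (cases "x < t (n+1)")
    case True
    with assms(1) have "t k \<le> x" "x < t (Suc k)" by (auto simp: in_piece_def)
    then have "t i \<le> x \<and> x < t (Suc i) \<longleftrightarrow> i = k"
      using monoD[OF mono_t, of "Suc i" k] monoD[OF mono_t, of "Suc k" i]
      by (cases i k rule: linorder_cases) auto
    with True show ?thesis unfolding cox_de_boor.simps e by simp
  next
    case False
    with in_piece_ends[OF assms(1)] have x: "x = t (n+1)" by simp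
    with False assms(1) monoD[OF mono_t, of "k+1" "n+1"] k have "k = n"
      by (auto simp: in_piece_def)
    then have "t i < x \<and> x \<le> t (Suc i) \<longleftrightarrow> i = k"
      using x right_end monoD[OF mono_t, of "Suc i" n] monoD[OF mono_t, of "Suc n" i]
      by (cases i n rule: linorder_cases) auto
    with False show ?thesis unfolding cox_de_boor.simps e by simp
  qed
next
  case (Suc q)
  have "\<Xi>\<langle>i\<rangle> = t i" "\<Xi>\<langle>i+1\<rangle> = t (i+1)" "\<Xi>\<langle>i+q+1\<rangle> = t (i+q+1)" "\<Xi>\<langle>i+q+2\<rangle> = t (i+q+2)"
    using Suc.prems by (simp_all add: knot_eq)
  then show ?case unfolding poly_bpoly_Suc cox_de_boor.simps using Suc by simp
qed

lemma bspline_eq: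
  assumes "in_piece k x" "i \<le> n"
  shows "bspline p \<Xi> i x = poly (bpoly t k p i) x"
proof -
  have "\<Xi>\<langle>n+1\<rangle> = t (n+1)" using n by (intro knot_eq[symmetric]) simp
  then show ?thesis unfolding bspline_def using cox_de_boor_eq[OF assms(1), of i p] assms(2) n by simp
qed

abbreviation cpoly where "cpoly c \<equiv> spoly t p (\<lambda>i. c\<langle>i\<rangle>)"

lemma spline_eq:
  assumes "in_piece k x"
  shows "spline p \<Xi> c x = poly (cpoly c k) x"
proof -
  have "spline p \<Xi> c x = (\<Sum>i=1..n. c\<langle>i\<rangle> * poly (bpoly t k p i) x)"
    unfolding spline_def by (intro sum.cong refl) (simp add: bspline_eq[OF assms])
  also have "\<dots> = (\<Sum>i=k-p..k. c\<langle>i\<rangle> * poly (bpoly t k p i) x)"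
    by (rule sum.mono_neutral_right) (use in_pieceD[OF assms] in \<open>auto simp: bpoly_outside\<close>)
  finally show ?thesis by (simp add: spoly_def poly_sum)
qed

lemma abs_spline_le:
  assumes "x \<in> {t (p+1)..t (n+1)}" "\<And>i. i \<in> {1..n} \<Longrightarrow> \<bar>c\<langle>i\<rangle>\<bar> \<le> M"
  shows "\<bar>spline p \<Xi> c x\<bar> \<le> M"
proof -
  obtain k where k: "in_piece k x" using ex_in_piece[OF assms(1)] by blast
  have "\<bar>spline p \<Xi> c x\<bar> \<le> (\<Sum>i=k-p..k. \<bar>c\<langle>i\<rangle> * poly (bpoly t k p i) x\<bar>)"
    unfolding spline_eq[OF k] spoly_def poly_sum poly_smult by (rule sum_abs)
  also have "\<dots> \<le> (\<Sum>i=k-p..k. M * poly (bpoly t k p i) x)"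
  proof (rule sum_mono)
    fix i assume "i \<in> {k-p..k}"
    then have "\<bar>c\<langle>i\<rangle>\<bar> \<le> M" using in_pieceD[OF k] by (intro assms(2)) auto
    then show "\<bar>c\<langle>i\<rangle> * poly (bpoly t k p i) x\<bar> \<le> M * poly (bpoly t k p i) x"
      using bpoly_nonneg[OF mono_t in_pieceD(3,4)[OF k], of p i]
      by (simp add: abs_mult mult_right_mono)
  qed
  also have "\<dots> = M"
    using sum_bpoly_eq_1[OF mono_t, of k p x] in_pieceD[OF k] by (simp flip: sum_distrib_left)
  finally show ?thesis .
qed

text \<open>The index of the last knot that is at most \<open>v\<close>.\<close>

definition K :: "real \<Rightarrow> nat" where "K v = card {i\<in>{1..length \<Xi>}. t i \<le> v}"

text \<open>By monotonicity the counted indices form an initial segment, so their number decides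
  membership.\<close>

lemma le_K_iff:
  assumes "i \<in> {1..length \<Xi>}" shows "t i \<le> v \<longleftrightarrow> i \<le> K v"
proof
  assume "t i \<le> v"
  then have "{1..i} \<subseteq> {i\<in>{1..length \<Xi>}. t i \<le> v}"
    using assms by (auto intro: order_trans[OF monoD[OF mono_t]])
  from card_mono[OF _ this] show "i \<le> K v" by (simp add: K_def)
next
  assume "i \<le> K v"
  show "t i \<le> v"
  proof (rule ccontr)
    assume "\<not> t i \<le> v"
    then have "{i\<in>{1..length \<Xi>}. t i \<le> v} \<subseteq> {1..<i}"
      using monoD[OF mono_t] by (auto simp: not_le) (meson le_less_trans not_le order_trans)
    from card_mono[OF _ this] have "K v \<le> i - 1" by (simp add: K_def)
    with \<open>i \<le> K v\<close> assms show False by auto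
  qed
qed

abbreviation Z where "Z \<equiv> breakpoints p \<Xi>"
abbreviation N where "N \<equiv> length Z"
abbreviation KZ where "KZ j \<equiv> K (Z\<langle>j\<rangle>)"

lemma set_Z: "set Z = t ` {p+1..n+1}" "sorted_wrt (<) Z"
proof -
  have "(\<lambda>i. \<Xi>\<langle>i\<rangle>) ` {p+1..n+1} = t ` {p+1..n+1}"
    using n by (intro image_cong) (auto simp: knot_eq)
  then show "set Z = t ` {p+1..n+1}" "sorted_wrt (<) Z"
    by (simp_all add: breakpoints_def)
qed

lemma Z_less: "1 \<le> i \<Longrightarrow> i < j \<Longrightarrow> j \<le> N \<Longrightarrow> Z\<langle>i\<rangle> < Z\<langle>j\<rangle>"
  using set_Z(2) by (auto simp: sorted_wrt_iff_nth_less)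

lemma Z_less_Suc: "j \<in> {1..N-1} \<Longrightarrow> Z\<langle>j\<rangle> < Z\<langle>j+1\<rangle>"
  by (rule Z_less) auto

lemma Z_le: "1 \<le> i \<Longrightarrow> i \<le> j \<Longrightarrow> j \<le> N \<Longrightarrow> Z\<langle>i\<rangle> \<le> Z\<langle>j\<rangle>"
  using Z_less[of i j] by (cases "i = j") auto

lemma Z_mem: "j \<in> {1..N} \<Longrightarrow> \<exists>i\<in>{p+1..n+1}. Z\<langle>j\<rangle> = t i"
  using set_Z(1) nth_mem[of "j - 1" Z] by fastforce

lemma mem_Z: "i \<in> {p+1..n+1} \<Longrightarrow> \<exists>j\<in>{1..N}. t i = Z\<langle>j\<rangle>"
proof -
  assume "i \<in> {p+1..n+1}"
  then have "t i \<in> set Z" by (simp add: set_Z)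
  then obtain j where "j < N" "Z ! j = t i" by (auto simp: in_set_conv_nth)
  then show ?thesis by (intro bexI[of _ "Suc j"]) auto
qed

lemma Z_ge: "j \<in> {1..N} \<Longrightarrow> t (p+1) \<le> Z\<langle>j\<rangle>" and Z_le_right: "j \<in> {1..N} \<Longrightarrow> Z\<langle>j\<rangle> \<le> t (n+1)"
  using Z_mem[of j] by (auto intro!: monoD[OF mono_t])

lemma N_pos: "1 \<le> N" and Z_first: "Z\<langle>1\<rangle> = t (p+1)" and Z_last: "Z\<langle>N\<rangle> = t (n+1)"
proof -
  obtain j where j: "j \<in> {1..N}" "t (p+1) = Z\<langle>j\<rangle>" using mem_Z[of "p+1"] n by auto
  then show "1 \<le> N" by simp
  then show "Z\<langle>1\<rangle> = t (p+1)" using Z_ge[of 1] Z_le[of 1 j] j by auto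
  obtain j where j: "j \<in> {1..N}" "t (n+1) = Z\<langle>j\<rangle>" using mem_Z[of "n+1"] n by auto
  then show "Z\<langle>N\<rangle> = t (n+1)" using Z_le_right[of N] Z_le[of j N] by auto
qed

lemma KZ:
  assumes "j \<in> {1..N-1}"
  shows "KZ j \<in> {p+1..n}" "t (KZ j) = Z\<langle>j\<rangle>" "t (KZ j + 1) = Z\<langle>j+1\<rangle>"
proof -
  have jN: "j \<in> {1..N}" "j + 1 \<in> {1..N}" using assms by auto
  obtain i where i: "i \<in> {p+1..n+1}" "Z\<langle>j\<rangle> = t i" using Z_mem[OF jN(1)] by auto
  have lt: "Z\<langle>j\<rangle> < Z\<langle>j+1\<rangle>" by (rule Z_less_Suc[OF assms])
  have "\<not> t (n+1) \<le> Z\<langle>j\<rangle>" using lt Z_le_right[OF jN(2)] by simp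
  then have K1: "KZ j \<le> n" using le_K_iff[of "n+1" "Z\<langle>j\<rangle>"] n by auto
  have K2: "i \<le> KZ j" using le_K_iff[of i "Z\<langle>j\<rangle>"] i n by auto
  show K: "KZ j \<in> {p+1..n}" using K1 K2 i by auto
  have "t (KZ j) \<le> Z\<langle>j\<rangle>" using le_K_iff[of "KZ j" "Z\<langle>j\<rangle>"] K n by auto
  with monoD[OF mono_t K2] i show "t (KZ j) = Z\<langle>j\<rangle>" by simp
  have "\<not> t (KZ j + 1) \<le> Z\<langle>j\<rangle>" using le_K_iff[of "KZ j + 1" "Z\<langle>j\<rangle>"] K n by auto
  moreover obtain l where l: "l \<in> {1..N}" "t (KZ j + 1) = Z\<langle>l\<rangle>" using mem_Z[of "KZ j + 1"] K by auto
  ultimately have "j < l" using Z_le[of l j] jN by (cases "l \<le> j") auto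
  then have 1: "Z\<langle>j+1\<rangle> \<le> t (KZ j + 1)" using Z_le[of "j+1" l] l by simp
  obtain i' where i': "i' \<in> {p+1..n+1}" "Z\<langle>j+1\<rangle> = t i'" using Z_mem[OF jN(2)] by auto
  have "KZ j + 1 \<le> i'" using le_K_iff[of i' "Z\<langle>j\<rangle>"] i' n lt by auto
  with monoD[OF mono_t this] i' 1 show "t (KZ j + 1) = Z\<langle>j+1\<rangle>" by simp
qed

lemma KZ_less: "j \<in> {1..N-1} \<Longrightarrow> t (KZ j) < t (Suc (KZ j))"
  using KZ[of j] Z_less_Suc[of j] by simp

lemma K_t:
  assumes "k \<in> {p+1..n}" "t k < t (Suc k)"
  shows "\<exists>j\<in>{1..N-1}. k = KZ j"
proof -
  obtain j where j: "j \<in> {1..N}" "t k = Z\<langle>j\<rangle>" using mem_Z[of k] assms(1) by auto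
  have "t (Suc k) \<le> t (n+1)" using assms(1) by (intro monoD[OF mono_t]) auto
  then have "j \<noteq> N" using j assms(2) Z_last by auto
  moreover have "KZ j = k"
    using le_K_iff[of k "Z\<langle>j\<rangle>"] le_K_iff[of "Suc k" "Z\<langle>j\<rangle>"] assms j n by auto
  ultimately show ?thesis using j by auto
qed

lemma KZ_1: "KZ 1 = p + 1"
  using le_K_iff[of "p+1" "Z\<langle>1\<rangle>"] le_K_iff[of "p+2" "Z\<langle>1\<rangle>"] left_end Z_first n by auto

lemma KZ_mono: "1 \<le> i \<Longrightarrow> i < j \<Longrightarrow> j \<le> N-1 \<Longrightarrow> KZ i < KZ j"
proof -
  assume ij: "1 \<le> i" "i < j" "j \<le> N-1"
  then have "Z\<langle>i\<rangle> < Z\<langle>j\<rangle>" by (intro Z_less) auto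
  with KZ[of j] le_K_iff[of "KZ j" "Z\<langle>i\<rangle>"] n ij show ?thesis by auto
qed

lemma KZ_last: assumes "2 \<le> N" shows "KZ (N-1) = n"
proof -
  have j: "N - 1 \<in> {1..N-1}" using assms by auto
  have "KZ (N-1) \<le> n" using KZ[OF j] by simp
  moreover have "\<not> KZ (N-1) < n"
  proof
    assume "KZ (N-1) < n"
    then have "t (KZ (N-1) + 1) \<le> t n" by (intro monoD[OF mono_t]) simp
    with KZ(3)[OF j] Z_last right_end assms show False by simp
  qed
  ultimately show ?thesis by simp
qed

lemma N_ge_2: "2 \<le> N"
proof -
  have "t (p+1) < t (n+1)" using left_end monoD[OF mono_t, of "p+2" "n+1"] n by auto
  then show ?thesis using Z_first Z_last N_pos by (cases "N = 1") auto
qed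

lemma KZ_eq_n_iff: "j \<in> {1..N-1} \<Longrightarrow> KZ j = n \<longleftrightarrow> j = N - 1"
  using KZ_last[OF N_ge_2] KZ_mono[of j "N-1"] by (cases "j = N-1") auto

lemma in_piece_KZ:
  assumes "j \<in> {1..N-1}" shows "x \<in> piece Z j \<longleftrightarrow> in_piece (KZ j) x"
  using KZ[OF assms] KZ_less[OF assms] KZ_eq_n_iff[OF assms] Z_last assms
  by (auto simp: piece_def in_piece_def)

lemma t_between:
  assumes "j \<in> {2..N-1}" "l \<in> {KZ (j-1) + 1..KZ j}" shows "t l = Z\<langle>j\<rangle>"
proof -
  have "t (KZ (j-1) + 1) = Z\<langle>j\<rangle>" using KZ(3)[of "j-1"] assms by fastforce
  moreover have "t (KZ j) = Z\<langle>j\<rangle>" using KZ(2)[of j] assms by simp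
  ultimately show ?thesis
    using monoD[OF mono_t, of "KZ (j-1) + 1" l] monoD[OF mono_t, of l "KZ j"] assms by simp
qed

lemma knot_mult_eq:
  assumes "j \<in> {2..N-1}" shows "knot_mult p \<Xi> j = KZ j - KZ (j-1)"
proof -
  have "knot_mult p \<Xi> j = card {i. i < length \<Xi> \<and> Z\<langle>j\<rangle> = \<Xi> ! i}"
    by (simp add: knot_mult_def count_list_eq_length_filter length_filter_conv_card)
  also have "\<dots> = card (Suc ` {i. i < length \<Xi> \<and> Z\<langle>j\<rangle> = \<Xi> ! i})"
    by (simp add: card_image)
  also have "Suc ` {i. i < length \<Xi> \<and> Z\<langle>j\<rangle> = \<Xi> ! i} = {i\<in>{1..length \<Xi>}. t i = Z\<langle>j\<rangle>}"
  proof (intro set_eqI iffI)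
    fix i assume i: "i \<in> {i\<in>{1..length \<Xi>}. t i = Z\<langle>j\<rangle>}"
    then show "i \<in> Suc ` {i. i < length \<Xi> \<and> Z\<langle>j\<rangle> = \<Xi> ! i}"
      by (intro image_eqI[of _ _ "i - 1"]) (auto simp: knot_eq)
  qed (auto simp: knot_eq)
  also have "\<dots> = {KZ (j-1) + 1..KZ j}"
  proof (intro set_eqI iffI)
    fix i assume i: "i \<in> {i\<in>{1..length \<Xi>}. t i = Z\<langle>j\<rangle>}"
    have "Z\<langle>j-1\<rangle> < Z\<langle>j\<rangle>" using Z_less[of "j-1" j] assms by auto
    with i le_K_iff[of i "Z\<langle>j\<rangle>"] le_K_iff[of i "Z\<langle>j-1\<rangle>"]
    show "i \<in> {KZ (j-1) + 1..KZ j}" by auto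
  next
    fix i assume i: "i \<in> {KZ (j-1) + 1..KZ j}"
    then show "i \<in> {i\<in>{1..length \<Xi>}. t i = Z\<langle>j\<rangle>}"
      using t_between[OF assms i] KZ(1)[of j] n assms by auto
  qed
  finally show ?thesis by simp
qed

text \<open>The multiplicities \<open>KZ j - KZ (j-1)\<close> telescope; the starting value
  \<open>KZ 1 = p + 1\<close> is where the gap \<open>left_end\<close> enters.\<close>

lemma last_knot_index_eq:
  assumes "j \<in> {1..N-1}" shows "last_knot_index p \<Xi> j = KZ j"
proof -
  have "1 \<le> j \<Longrightarrow> j \<le> N-1 \<Longrightarrow> last_knot_index p \<Xi> j = KZ j"
  proof (induction j rule: nat_induct_at_least)
    case base
    then show ?case using KZ_1 by (simp add: last_knot_index_def)
  next
    case (Suc j)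
    then show ?case using knot_mult_eq[of "Suc j"] KZ_mono[of j "Suc j"]
      by (simp add: last_knot_index_def)
  qed
  then show ?thesis using assms by simp
qed

end

section \<open>The B-spline basis and knot insertion\<close>

lemma root_power_dvd_psi:
  assumes "{k+1..k'} \<subseteq> {i+1..i+q}" "\<And>l. l \<in> {k+1..k'} \<Longrightarrow> t l = z"
  shows "[:- z, 1:] ^ (k' - k) dvd psi t q i"
proof -
  have "(\<Prod>l\<in>{k+1..k'}. [:- t l, 1:]) = (\<Prod>l\<in>{k+1..k'}. [:- z, 1:])"
    by (rule prod.cong) (simp_all add: assms(2))
  then have "[:- z, 1:] ^ (k' - k) = (\<Prod>l\<in>{k+1..k'}. [:- t l, 1:])" by simp
  also have "\<dots> dvd psi t q i"
    unfolding psi_def by (rule prod_dvd_prod_subset[OF _ assms(1)]) simp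
  finally show ?thesis .
qed

context knot_vector
begin

lemma in_piece_left:
  assumes "j \<in> {2..N-1}" "y \<in> {Z\<langle>j-1\<rangle><..<Z\<langle>j\<rangle>}" shows "in_piece (KZ (j-1)) y"
proof -
  have "j - 1 \<in> {1..N-1}" "j - 1 + 1 = j" using assms by auto
  with KZ[of "j-1"] assms(2) show ?thesis by (auto simp: in_piece_def)
qed

lemma in_piece_right:
  assumes "j \<in> {1..N-1}" "y \<in> {Z\<langle>j\<rangle>..<Z\<langle>j+1\<rangle>}" shows "in_piece (KZ j) y"
  using KZ[OF assms(1)] assms(2) by (auto simp: in_piece_def)

lemma interior_index:
  assumes "j \<in> {2..N-1}"
  shows "j - 1 \<in> {1..N-1}" "j \<in> {1..N-1}" "j - 1 + 1 = j" "Z\<langle>j-1\<rangle> < Z\<langle>j\<rangle>" "Z\<langle>j\<rangle> < Z\<langle>j+1\<rangle>"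
    "KZ (j-1) < KZ j" "t (KZ (j-1)) < Z\<langle>j\<rangle>" "Z\<langle>j\<rangle> < t (Suc (KZ j))"
proof -
  show 1: "j - 1 \<in> {1..N-1}" "j \<in> {1..N-1}" "j - 1 + 1 = j" using assms by auto
  show 2: "Z\<langle>j-1\<rangle> < Z\<langle>j\<rangle>" "Z\<langle>j\<rangle> < Z\<langle>j+1\<rangle>" using Z_less_Suc[OF 1(1)] Z_less_Suc[OF 1(2)] 1(3) by auto
  show "KZ (j-1) < KZ j" using assms by (intro KZ_mono) auto
  show "t (KZ (j-1)) < Z\<langle>j\<rangle>" using KZ(2)[OF 1(1)] 2(1) by simp
  show "Z\<langle>j\<rangle> < t (Suc (KZ j))" using KZ(3)[OF 1(2)] 2(2) by simp
qed

theorem spline_in_spline_space: "spline p \<Xi> c \<in> spline_space_of_knots p \<Xi>"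
proof -
  have "\<exists>P. degree P \<le> p \<and> (\<forall>x\<in>piece Z j. spline p \<Xi> c x = poly P x)" if j: "j \<in> {1..N-1}" for j
    by (rule exI[of _ "cpoly c (KZ j)"]) (simp add: in_piece_KZ[OF j] degree_spoly spline_eq)
  moreover have "has_cont_derivs_at (p - knot_mult p \<Xi> j) (spline p \<Xi> c) (Z\<langle>j\<rangle>)"
    if j: "j \<in> {2..N-1}" and m: "knot_mult p \<Xi> j \<le> p" for j
  proof (rule has_cont_derivs_atI)
    note ij = interior_index[OF j]
    show "Z\<langle>j-1\<rangle> < Z\<langle>j\<rangle>" "Z\<langle>j\<rangle> < Z\<langle>j+1\<rangle>" by (fact ij)+
    show "spline p \<Xi> c y = poly (cpoly c (KZ (j-1))) y" if "y \<in> {Z\<langle>j-1\<rangle><..<Z\<langle>j\<rangle>}" for y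
      by (rule spline_eq) (rule in_piece_left[OF j that])
    show "spline p \<Xi> c y = poly (cpoly c (KZ j)) y" if "y \<in> {Z\<langle>j\<rangle>..<Z\<langle>j+1\<rangle>}" for y
      by (rule spline_eq) (rule in_piece_right[OF ij(2) that])
    show "poly (pderivs r (cpoly c (KZ (j-1)))) (Z\<langle>j\<rangle>) = poly (pderivs r (cpoly c (KZ j))) (Z\<langle>j\<rangle>)"
      if "r \<le> p - knot_mult p \<Xi> j" for r
    proof (rule spoly_smooth[OF mono_t ij(7,8)])
      show "t l = Z\<langle>j\<rangle>" if "l \<in> {KZ (j-1) + 1..KZ j}" for l by (rule t_between[OF j that])
      show "KZ (j-1) < KZ j" by (fact ij)
      show "p \<le> KZ (j-1)" using KZ(1)[OF ij(1)] by auto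
      show "KZ j + r \<le> KZ (j-1) + p" using that m ij(6) unfolding knot_mult_eq[OF j] by linarith
    qed
  qed
  ultimately show ?thesis by (simp add: spline_space_of_knots_def spline_space_def)
qed

text \<open>Each B-spline must be visible on \<open>[a, b]\<close>. If its support reaches an end of
  the interval, the gap at this end serves; otherwise its \<open>p+2\<close> knots all lie in the
  interior and cannot all coincide.\<close>

lemma ex_piece_index:
  assumes "i \<in> {1..n}" shows "\<exists>j\<in>{1..N-1}. KZ j \<in> {i..i+p}"
proof -
  have "\<exists>k\<in>{p+1..n} \<inter> {i..i+p}. t k < t (Suc k)"
  proof -
    consider "i \<le> p + 1" | "n \<le> i + p" | "p + 1 < i" "i + p < n" by linarith
    then show ?thesis
    proof cases
      case 1
      then show ?thesis using assms left_end n by (intro bexI[of _ "p+1"]) auto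
    next
      case 2
      then show ?thesis using assms right_end n by (intro bexI[of _ n]) auto
    next
      case 3
      have "\<exists>k\<in>{i..i+p}. t k < t (Suc k)"
      proof (rule ccontr)
        assume "\<not> ?thesis"
        then have *: "t (Suc k) \<le> t k" if "k \<in> {i..i+p}" for k using that not_less by blast
        have "d \<le> p + 1 \<Longrightarrow> t (i + d) \<le> t i" for d
        proof (induction d)
          case (Suc d)
          then show ?case using *[of "i + d"] by auto
        qed simp
        from this[of "p+1"] mult[OF assms] show False by (simp add: add.assoc)
      qed
      then show ?thesis using 3 by auto
    qed
  qed
  then show ?thesis using K_t by (metis IntE)
qed

text \<open>A nonempty interval in the support of the \<open>i\<close>-th B-spline has infinitely
  many points, so it determines the polynomial piece there, and with it the pairing that equals the
  coefficient.\<close>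

theorem spline_coeffs_unique:
  assumes "\<And>x. x \<in> {t (p+1)..t (n+1)} \<Longrightarrow> spline p \<Xi> c x = spline p \<Xi> d x" and i: "i \<in> {1..n}"
  shows "c\<langle>i\<rangle> = d\<langle>i\<rangle>"
proof -
  obtain j where j: "j \<in> {1..N-1}" "KZ j \<in> {i..i+p}" using ex_piece_index[OF i] by blast
  have "poly (cpoly c (KZ j)) x = poly (cpoly d (KZ j)) x" if "x \<in> {Z\<langle>j\<rangle>..<Z\<langle>j+1\<rangle>}" for x
    using assms(1)[OF in_piece_ends[OF in_piece_right[OF j(1) that]]]
    by (simp add: spline_eq[OF in_piece_right[OF j(1) that]])
  then have "{Z\<langle>j\<rangle>..<Z\<langle>j+1\<rangle>} \<subseteq> {x. poly (cpoly c (KZ j) - cpoly d (KZ j)) x = 0}"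
    by auto
  moreover have "infinite {Z\<langle>j\<rangle>..<Z\<langle>j+1\<rangle>}" using Z_less_Suc[OF j(1)] by (simp add: infinite_Ico)
  ultimately have "infinite {x. poly (cpoly c (KZ j) - cpoly d (KZ j)) x = 0}"
    using infinite_super by blast
  then have "cpoly c (KZ j) - cpoly d (KZ j) = 0" by (metis poly_roots_finite)
  then have "cpoly c (KZ j) = cpoly d (KZ j)" by simp
  moreover have "p \<le> KZ j" "i \<in> {KZ j - p..KZ j}" using KZ(1)[OF j(1)] j by auto
  ultimately show ?thesis
    using dual_spoly[OF mono_t KZ_less[OF j(1)], of p i "\<lambda>i. c\<langle>i\<rangle>"]
      dual_spoly[OF mono_t KZ_less[OF j(1)], of p i "\<lambda>i. d\<langle>i\<rangle>"] by simp
qed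

text \<open>The coefficient of index \<open>i\<close> is the pairing of a piece of \<open>f\<close>
  with \<open>psi t p i\<close>. The point is that it does not depend on the piece within the
  support: derivatives of low order of neighbouring pieces agree at the breakpoint, and the
  complementary derivatives of \<open>psi t p i\<close> vanish there by its multiple root.\<close>

theorem spline_space_coeffs:
  assumes "f \<in> spline_space_of_knots p \<Xi>"
  shows "\<exists>c. length c = n \<and> (\<forall>x\<in>{t (p+1)..t (n+1)}. f x = spline p \<Xi> c x)"
proof -
  have "\<forall>j\<in>{1..N-1}. \<exists>P. degree P \<le> p \<and> (\<forall>x\<in>piece Z j. f x = poly P x)"
    using assms by (simp add: spline_space_of_knots_def spline_space_def)
  then obtain P where P: "\<And>j. j \<in> {1..N-1} \<Longrightarrow> degree (P j) \<le> p"
    "\<And>j x. j \<in> {1..N-1} \<Longrightarrow> in_piece (KZ j) x \<Longrightarrow> f x = poly (P j) x"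
    by (metis in_piece_KZ)
  define lam where "lam j i = dual p (P j) (psi t p i)" for j i
  have step: "lam (j-1) i = lam j i" if j: "j \<in> {2..N-1}" and i: "i \<le> KZ (j-1)" "KZ j \<le> i + p" for i j
  proof -
    note ij = interior_index[OF j]
    define m where "m = KZ j - KZ (j-1)"
    \<comment> \<open>Both intervals lie in the support of the \<open>i\<close>-th B-spline, so the
      multiplicity is at most \<open>p\<close> and the smoothness condition of the space
      applies.\<close>
    have m: "knot_mult p \<Xi> j = m" "m \<le> p"
      using i ij(6) unfolding m_def knot_mult_eq[OF j] by linarith+
    then have cont: "has_cont_derivs_at (p - m) f (Z\<langle>j\<rangle>)"
      using assms j by (auto simp: spline_space_of_knots_def spline_space_def)
    have match: "poly (pderivs r (P (j-1))) (Z\<langle>j\<rangle>) = poly (pderivs r (P j)) (Z\<langle>j\<rangle>)" if "r \<le> p - m" for r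
      by (rule has_cont_derivs_at_matching[OF ij(4,5) _ _ cont that])
         (use P(2) ij(1,2) in_piece_left[OF j] in_piece_right[OF ij(2)] in auto)
    have dvd: "[:- Z\<langle>j\<rangle>, 1:] ^ m dvd psi t p i"
      unfolding m_def by (rule root_power_dvd_psi) (use i t_between[OF j] in auto)
    have "dual p (P (j-1) - P j) (psi t p i) = (\<Sum>r\<le>p. (-1) ^ r *
      poly (pderivs r (P (j-1) - P j)) (Z\<langle>j\<rangle>) * poly (pderivs (p - r) (psi t p i)) (Z\<langle>j\<rangle>)) / fact p"
      by (rule dual_at) (use P(1) ij(1,2) degree_psi in \<open>auto intro!: degree_diff_le\<close>)
    also have "\<dots> = 0"
    proof -
      have "poly (pderivs r (P (j-1) - P j)) (Z\<langle>j\<rangle>) * poly (pderivs (p - r) (psi t p i)) (Z\<langle>j\<rangle>) = 0"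
        if "r \<le> p" for r
      proof (cases "r \<le> p - m")
        case True
        from match[OF this] show ?thesis by (simp add: pderivs_linear)
      next
        case False
        then show ?thesis using pderivs_root[OF dvd, of "p - r"] that by simp
      qed
      then have "\<forall>r\<in>{..p}. (-1) ^ r * poly (pderivs r (P (j-1) - P j)) (Z\<langle>j\<rangle>) *
          poly (pderivs (p - r) (psi t p i)) (Z\<langle>j\<rangle>) = 0" by (auto simp: mult.assoc)
      from sum.neutral[OF this] show ?thesis by simp
    qed
    finally show ?thesis by (simp add: lam_def dual_linear)
  qed
  \<comment> \<open>As \<open>KZ\<close> is increasing, the pieces in the support are consecutive,
    so the comparison of neighbours chains.\<close>
  have lam_le: "lam j i = lam j' i"
    if "j \<le> j'" "1 \<le> j" "j' \<le> N-1" "KZ j \<in> {i..i+p}" "KZ j' \<in> {i..i+p}" for i j j'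
    using that
  proof (induction j' rule: dec_induct)
    case (step l)
    have l: "KZ j \<le> KZ l" using KZ_mono[of j l] step.hyps step.prems by (cases "j = l") auto
    have l': "KZ l < KZ (Suc l)" using KZ_mono[of l "Suc l"] step.hyps step.prems by auto
    have "lam j i = lam l i" using step l l' by auto
    also have "\<dots> = lam (Suc l) i"
      using \<open>\<And>j i. \<lbrakk>j \<in> {2..N-1}; i \<le> KZ (j-1); KZ j \<le> i + p\<rbrakk> \<Longrightarrow> lam (j-1) i = lam j i\<close>[of "Suc l" i]
        step.hyps step.prems l by simp
    finally show ?case .
  qed simp
  have lam: "lam j i = lam j' i"
    if "j \<in> {1..N-1}" "j' \<in> {1..N-1}" "KZ j \<in> {i..i+p}" "KZ j' \<in> {i..i+p}" for i j j'
  proof (cases "j \<le> j'")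
    case True
    then show ?thesis using that by (intro lam_le) simp_all
  next
    case False
    then show ?thesis using that by (intro lam_le[symmetric]) simp_all
  qed
  obtain J where J: "\<And>i. i \<in> {1..n} \<Longrightarrow> J i \<in> {1..N-1} \<and> KZ (J i) \<in> {i..i+p}"
    using bchoice[of "{1..n}" "\<lambda>i j. j \<in> {1..N-1} \<and> KZ j \<in> {i..i+p}"] ex_piece_index by blast
  define c where "c = map (\<lambda>i. lam (J i) i) [1..<n+1]"
  have c: "c\<langle>i\<rangle> = lam (J i) i" if "i \<in> {1..n}" for i
    using that by (auto simp: c_def simp del: upt_Suc)
  have "f x = spline p \<Xi> c x" if x: "x \<in> {t (p+1)..t (n+1)}" for x
  proof -
    obtain k where k: "in_piece k x" using ex_in_piece[OF x] by blast
    obtain j where j: "j \<in> {1..N-1}" "k = KZ j" using K_t in_pieceD[OF k] by metis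
    have "cpoly c (KZ j) = P j"
    proof (rule spoly_dual[OF mono_t KZ_less[OF j(1)]])
      show "degree (P j) \<le> p" by (rule P(1)[OF j(1)])
      show "p \<le> KZ j" using in_pieceD[OF k] j by simp
      fix i assume i: "i \<in> {KZ j - p..KZ j}"
      have i': "i \<in> {1..n}" using i in_pieceD(1)[OF k] j by auto
      have "lam (J i) i = lam j i" using J[OF i'] j i by (intro lam) auto
      then show "c\<langle>i\<rangle> = dual p (P j) (psi t p i)" unfolding c[OF i'] by (simp add: lam_def)
    qed
    then show ?thesis using P(2)[OF j(1)] k j spline_eq[OF k] by simp
  qed
  moreover have "length c = n" by (simp add: c_def)
  ultimately show ?thesis by blast
qed

lemma ends: "\<Xi>\<langle>p+1\<rangle> = t (p+1)" "\<Xi>\<langle>n+1\<rangle> = t (n+1)"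
  by (rule knot_eq[symmetric], use n in simp)+

lemma control_points_eq:
  assumes "length c = n" "\<And>x. x \<in> {t (p+1)..t (n+1)} \<Longrightarrow> f x = spline p \<Xi> c x"
  shows "control_points p \<Xi> f = c"
  unfolding control_points_def ends
proof (rule the_equality)
  fix d assume d: "length d = n \<and> (\<forall>x\<in>{t (p+1)..t (n+1)}. f x = spline p \<Xi> d x)"
  show "d = c"
  proof (rule nth_equalityI)
    show "length d = length c" using d assms(1) by simp
    fix i assume i: "i < length d"
    have "d\<langle>Suc i\<rangle> = c\<langle>Suc i\<rangle>"
    proof (rule spline_coeffs_unique)
      show "spline p \<Xi> d x = spline p \<Xi> c x" if "x \<in> {t (p+1)..t (n+1)}" for x
        using d assms(2)[OF that] that by metis
      show "Suc i \<in> {1..n}" using i d by simp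
    qed
    then show "d ! i = c ! i" by simp
  qed
next
  show "length c = n \<and> (\<forall>x\<in>{t (p+1)..t (n+1)}. f x = spline p \<Xi> c x)"
    by (intro conjI ballI assms)
qed

end

section \<open>Boehm's knot insertion\<close>

definition skip :: "nat \<Rightarrow> nat \<Rightarrow> nat" where "skip i\<^sub>0 l = (if l < i\<^sub>0 then l else Suc l)"

lemma remove_index_nth:
  assumes "1 \<le> i\<^sub>0" "i\<^sub>0 \<le> length xs"
  shows "remove_index i\<^sub>0 xs ! m = xs ! (if m < i\<^sub>0 - 1 then m else Suc m)"
proof (cases "m < i\<^sub>0 - 1")
  case False
  then have "i\<^sub>0 + (m - (i\<^sub>0 - 1)) = Suc m" using assms by simp
  moreover have "length (take (i\<^sub>0 - 1) xs) = i\<^sub>0 - 1" using assms by simp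
  ultimately show ?thesis using False assms
    by (simp add: remove_index_def nth_append del: length_take)
qed (use assms in \<open>simp add: remove_index_def nth_append\<close>)

lemma length_remove_index:
  "1 \<le> i\<^sub>0 \<Longrightarrow> i\<^sub>0 \<le> length \<Xi> \<Longrightarrow> length (remove_index i\<^sub>0 \<Xi>) = length \<Xi> - 1"
  by (simp add: remove_index_def)

text \<open>Clamping commutes with the reindexing because neither the first nor the last knot is
  removed.\<close>

lemma knot_remove_index:
  assumes "2 \<le> i\<^sub>0" "i\<^sub>0 < length \<Xi>"
  shows "knot (remove_index i\<^sub>0 \<Xi>) l = knot \<Xi> (skip i\<^sub>0 l)"
proof -
  have "(if min l (length \<Xi> - 1) - 1 < i\<^sub>0 - 1 then min l (length \<Xi> - 1) - 1 else Suc (min l (length \<Xi> - 1) - 1)) =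
      min (if l < i\<^sub>0 then l else Suc l) (length \<Xi>) - 1"
    using assms by (simp only: min_def split: if_split) arith
  moreover have "1 \<le> i\<^sub>0" "i\<^sub>0 \<le> length \<Xi>" using assms by auto
  ultimately show ?thesis
    unfolding knot_def skip_def by (simp only: length_remove_index remove_index_nth)
qed

lemma skip_image:
  "i < i\<^sub>0 \<Longrightarrow> i\<^sub>0 \<le> i + q + 1 \<Longrightarrow> skip i\<^sub>0 ` {i+1..i+q} = {i+1..i+q+1} - {i\<^sub>0}"
proof (intro set_eqI iffI)
  fix l assume "i < i\<^sub>0" "i\<^sub>0 \<le> i + q + 1" "l \<in> {i+1..i+q+1} - {i\<^sub>0}"
  then show "l \<in> skip i\<^sub>0 ` {i+1..i+q}"
    by (intro image_eqI[of _ _ "if l < i\<^sub>0 then l else l - 1"]) (auto simp: skip_def)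
qed (auto simp: skip_def)

lemma psi_skip:
  "psi (\<lambda>l. t (skip i\<^sub>0 l)) q i = (\<Prod>l\<in>skip i\<^sub>0 ` {i+1..i+q}. [:- t l, 1:])"
  unfolding psi_def by (subst prod.reindex) (auto simp: inj_on_def skip_def split: if_splits)

text \<open>Boehm's knot insertion coefficients, for the insertion of the knot with (new) index \<open>i\<^sub>0\<close>.\<close>

definition ins_coeff :: "(nat \<Rightarrow> real) \<Rightarrow> nat \<Rightarrow> nat \<Rightarrow> nat \<Rightarrow> real" where
  "ins_coeff t q i\<^sub>0 i =
     (if i + q < i\<^sub>0 then 1 else if i\<^sub>0 \<le> i then 0 else (t i\<^sub>0 - t i) / (t (i+q+1) - t i))"

text \<open>In the essential case the three products share \<open>M\<close> and differ in one root:
  \<open>t i\<^sub>0\<close>, \<open>t (i+q+1)\<close> and \<open>t i\<close>. The coefficient is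
  the one that interpolates the first root between the other two.\<close>

lemma psi_knot_insertion:
  fixes t :: "nat \<Rightarrow> real"
  assumes "i > 0" "t i \<noteq> t (i+q+1)" "i\<^sub>0 > 0"
  defines "t' \<equiv> \<lambda>l. t (skip i\<^sub>0 l)"
  shows "psi t q i = smult (ins_coeff t q i\<^sub>0 i) (psi t' q i) +
    smult (1 - ins_coeff t q i\<^sub>0 i) (psi t' q (i-1))"
proof -
  consider "i + q < i\<^sub>0" | "i\<^sub>0 \<le> i" | "i < i\<^sub>0" "i\<^sub>0 \<le> i + q" by linarith
  then show ?thesis
  proof cases
    case 1
    then have "psi t' q i = psi t q i" unfolding psi_def t'_def
      by (intro prod.cong) (auto simp: skip_def)
    with 1 show ?thesis by (simp add: ins_coeff_def)
  next
    case 2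
    have "psi t' q (i-1) = (\<Prod>l\<in>{i..i-1+q}. [:- t (Suc l), 1:])"
      using 2 assms(1) unfolding psi_def t'_def by (intro prod.cong) (auto simp: skip_def)
    also have "\<dots> = psi t q i" unfolding psi_def
      using assms(1) by (subst prod.shift_bounds_cl_Suc_ivl[symmetric]) simp
    finally show ?thesis using 2 by (simp add: ins_coeff_def)
  next
    case 3
    define M where "M = (\<Prod>l\<in>{i+1..i+q} - {i\<^sub>0}. [:- t l, 1:])"
    have a: "psi t q i = [:- t i\<^sub>0, 1:] * M"
      unfolding psi_def M_def by (rule prod.remove) (use 3 in auto)
    have "{i+1..i+q+1} - {i\<^sub>0} = insert (i+q+1) ({i+1..i+q} - {i\<^sub>0})" using 3 by auto
    then have b: "psi t' q i = [:- t (i+q+1), 1:] * M"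
      unfolding t'_def psi_skip M_def using 3 by (subst skip_image) auto
    have "skip i\<^sub>0 ` {i-1+1..i-1+q} = {i-1+1..i-1+q+1} - {i\<^sub>0}"
      by (rule skip_image) (use 3 in auto)
    also have "\<dots> = insert i ({i+1..i+q} - {i\<^sub>0})" using 3 assms(1) by auto
    finally have c: "psi t' q (i-1) = [:- t i, 1:] * M"
      unfolding t'_def psi_skip M_def by simp
    define u where "u = ins_coeff t q i\<^sub>0 i"
    have "u * (t (i+q+1) - t i) = t i\<^sub>0 - t i"
      using 3 assms(2) by (simp add: u_def ins_coeff_def)
    then have u: "u * t (i+q+1) + (1 - u) * t i = t i\<^sub>0" by (simp add: algebra_simps)
    have "poly (psi t q i) y = poly (smult u (psi t' q i) + smult (1 - u) (psi t' q (i-1))) y" for y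
      unfolding a b c u[symmetric] by (simp add: algebra_simps)
    then show ?thesis unfolding u_def by (intro poly_ext)
  qed
qed

text \<open>For \<open>i\<^sub>0\<close> in \<open>{p+2..n}\<close>, with \<open>n\<close> the
  dimension, the meaningless entries 0 and \<open>n\<close> of \<open>d\<close> get the factor zero:
  the insertion coefficient is 1 at \<open>i = 1\<close> and 0 at \<open>i = n\<close>.\<close>

definition insert_knot_coeffs :: "nat \<Rightarrow> real list \<Rightarrow> nat \<Rightarrow> real list \<Rightarrow> real list" where
  "insert_knot_coeffs p \<Xi> i\<^sub>0 d = map (\<lambda>i. ins_coeff (knot \<Xi>) p i\<^sub>0 i * d\<langle>i\<rangle> +
     (1 - ins_coeff (knot \<Xi>) p i\<^sub>0 i) * d\<langle>i-1\<rangle>) [1..<spline_dim p \<Xi> + 1]"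

lemma insert_knot_coeffs_nth:
  assumes "i \<in> {1..spline_dim p \<Xi>}"
  shows "(insert_knot_coeffs p \<Xi> i\<^sub>0 d)\<langle>i\<rangle> = ins_coeff (knot \<Xi>) p i\<^sub>0 i * d\<langle>i\<rangle> +
     (1 - ins_coeff (knot \<Xi>) p i\<^sub>0 i) * d\<langle>i-1\<rangle>"
  using assms by (auto simp: insert_knot_coeffs_def simp del: upt_Suc)

context knot_vector
begin

context
  fixes i\<^sub>0 assumes i\<^sub>0: "i\<^sub>0 \<in> {p+2..n}"
begin

lemma knot_removed: "knot (remove_index i\<^sub>0 \<Xi>) = (\<lambda>l. t (skip i\<^sub>0 l))"
  using i\<^sub>0 n by (intro ext knot_remove_index) auto

lemma dim_removed: "spline_dim p (remove_index i\<^sub>0 \<Xi>) = n - 1"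
  using i\<^sub>0 n by (simp add: spline_dim_def length_remove_index)

text \<open>Losing an interior knot can only widen the gaps in question, so every strict inequality
  persists; this makes the locale an invariant of the loop.\<close>

lemma knot_vector_removed: "knot_vector p (remove_index i\<^sub>0 \<Xi>)"
proof
  show "sorted (remove_index i\<^sub>0 \<Xi>)"
  proof -
    have "sorted (take (i\<^sub>0 - 1) \<Xi> @ drop (i\<^sub>0 - 1) \<Xi>)" using sorted by simp
    moreover have "set (drop i\<^sub>0 \<Xi>) \<subseteq> set (drop (i\<^sub>0 - 1) \<Xi>)"
      by (rule set_drop_subset_set_drop) simp
    ultimately show ?thesis
      unfolding remove_index_def sorted_append using sorted_wrt_drop[OF sorted] by blast
  qed
  show "2 * p + 2 \<le> length (remove_index i\<^sub>0 \<Xi>)"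
    using i\<^sub>0 n by (auto simp: length_remove_index)
  show "knot (remove_index i\<^sub>0 \<Xi>) (p + 1) < knot (remove_index i\<^sub>0 \<Xi>) (p + 2)"
    using i\<^sub>0 left_end monoD[OF mono_t, of "p+2" "Suc (p+2)"]
    unfolding knot_removed by (auto simp: skip_def)
  show "knot (remove_index i\<^sub>0 \<Xi>) (spline_dim p (remove_index i\<^sub>0 \<Xi>))
    < knot (remove_index i\<^sub>0 \<Xi>) (spline_dim p (remove_index i\<^sub>0 \<Xi>) + 1)"
    using i\<^sub>0 right_end monoD[OF mono_t, of "n-1" n]
    unfolding knot_removed dim_removed by (auto simp: skip_def)
  show "knot (remove_index i\<^sub>0 \<Xi>) i < knot (remove_index i\<^sub>0 \<Xi>) (i + p + 1)"
    if "i \<in> {1..spline_dim p (remove_index i\<^sub>0 \<Xi>)}" for i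
    using that mult[of i] mult[of "Suc i"] i\<^sub>0 monoD[OF mono_t, of "i+p+1" "Suc (i+p+1)"]
    unfolding knot_removed dim_removed by (auto simp: skip_def)
qed

interpretation R: knot_vector p "remove_index i\<^sub>0 \<Xi>" by (rule knot_vector_removed)

lemma removed_ends: "R.t (p+1) = t (p+1)" "R.t (R.n+1) = t (n+1)"
  unfolding knot_removed dim_removed using i\<^sub>0 n by (auto simp: skip_def)

theorem knot_insertion:
  assumes x: "x \<in> {t (p+1)..t (n+1)}"
  shows "spline p (remove_index i\<^sub>0 \<Xi>) d x = spline p \<Xi> (insert_knot_coeffs p \<Xi> i\<^sub>0 d) x"
proof -
  obtain k where k: "in_piece k x" using ex_in_piece[OF x] by blast
  note kD = in_pieceD[OF k]
  \<comment> \<open>The two intervals adjacent to the removed knot merge into the one of index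
    \<open>i\<^sub>0 - 1\<close>; later intervals move down by one.\<close>
  define k' where "k' = (if k < i\<^sub>0 then k else k - 1)"
  have k': "R.in_piece k' x"
  proof (cases "k < i\<^sub>0")
    case True
    with k i\<^sub>0 have "x < t (Suc k)" by (auto simp: in_piece_def)
    also have "\<dots> \<le> t (Suc (Suc k))" by (intro monoD[OF mono_t]) simp
    finally show ?thesis using k True i\<^sub>0 \<open>x < t (Suc k)\<close>
      by (auto simp: R.in_piece_def in_piece_def k'_def knot_removed dim_removed skip_def)
  next
    case False
    have "t (k - 1) \<le> t k" by (intro monoD[OF mono_t]) simp
    with k False i\<^sub>0 show ?thesis
      by (auto simp: R.in_piece_def in_piece_def k'_def knot_removed dim_removed skip_def)
  qed
  define P where "P = R.cpoly d k'"
  have "cpoly (insert_knot_coeffs p \<Xi> i\<^sub>0 d) k = P"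
  proof (rule spoly_dual[OF mono_t kD(2,5)])
    show "degree P \<le> p" unfolding P_def by (rule degree_spoly)
    fix i assume i: "i \<in> {k-p..k}"
    with kD have i': "i \<in> {1..n}" by auto
    have dual: "dual p P (psi R.t p j) = d\<langle>j\<rangle>" if "j \<in> {k'-p..k'}" for j
      unfolding P_def by (rule dual_spoly[OF R.mono_t R.in_pieceD(2,5)[OF k'] that])
    define u where "u = ins_coeff t p i\<^sub>0 i"
    have "dual p P (psi t p i) = u * dual p P (psi R.t p i) + (1 - u) * dual p P (psi R.t p (i-1))"
      using psi_knot_insertion[of i t p i\<^sub>0] mult[OF i'] i' i\<^sub>0
      unfolding u_def knot_removed by (simp add: dual_linear)
    \<comment> \<open>The pairing is known only for indices in the range of piece \<open>k'\<close>.
      An index outside it occurs only at an end of the range, where the factor \<open>u\<close>, or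
      \<open>1 - u\<close> below, is zero.\<close>
    moreover have "u * dual p P (psi R.t p i) = u * d\<langle>i\<rangle>"
    proof (cases "i \<in> {k'-p..k'}")
      case False
      with i kD have "i\<^sub>0 \<le> i" by (auto simp: k'_def split: if_splits)
      then show ?thesis by (simp add: u_def ins_coeff_def)
    qed (simp add: dual)
    moreover have "(1 - u) * dual p P (psi R.t p (i-1)) = (1 - u) * d\<langle>i-1\<rangle>"
    proof (cases "i - 1 \<in> {k'-p..k'}")
      case False
      with i kD have "i + p < i\<^sub>0" by (auto simp: k'_def split: if_splits)
      then show ?thesis by (simp add: u_def ins_coeff_def)
    qed (use dual[of "i-1"] in simp)
    ultimately show "(insert_knot_coeffs p \<Xi> i\<^sub>0 d)\<langle>i\<rangle> = dual p P (psi t p i)"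
      unfolding insert_knot_coeffs_nth[OF i'] u_def[symmetric] by linarith
  qed
  then show ?thesis unfolding R.spline_eq[OF k'] spline_eq[OF k] P_def by simp
qed

end

end

section \<open>Removal of one knot\<close>

text \<open>\<mu> is a left null vector: each \<open>z r\<close> occurs in rows \<open>r\<close> and
  \<open>Suc r\<close> only, with opposite contributions. The boundary values of \<alpha> remove
  \<open>z 0\<close> and \<open>z (Suc D)\<close>.\<close>

lemma bidiagonal_annihilator:
  fixes \<alpha> \<mu> z :: "nat \<Rightarrow> real"
  assumes "\<alpha> 1 = 1" "\<alpha> (Suc D) = 0"
    and "\<And>r. r \<in> {1..D} \<Longrightarrow> \<mu> (Suc r) * (1 - \<alpha> (Suc r)) = - \<mu> r * \<alpha> r"
  shows "(\<Sum>r=1..Suc D. \<mu> r * (\<alpha> r * z r + (1 - \<alpha> r) * z (r-1))) = 0"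
proof -
  have "(\<Sum>r=1..Suc D. \<mu> r * (\<alpha> r * z r + (1 - \<alpha> r) * z (r-1))) =
     (\<Sum>r=1..Suc D. \<mu> r * \<alpha> r * z r) + (\<Sum>r=1..Suc D. \<mu> r * (1 - \<alpha> r) * z (r-1))"
    by (simp add: sum.distrib[symmetric] distrib_left mult.assoc del: sum.cl_ivl_Suc)
  also have "(\<Sum>r=1..Suc D. \<mu> r * \<alpha> r * z r) = (\<Sum>r=1..D. \<mu> r * \<alpha> r * z r)"
    by (simp add: assms(2))
  also have "(\<Sum>r=1..Suc D. \<mu> r * (1 - \<alpha> r) * z (r-1)) = (\<Sum>r=Suc 1..Suc D. \<mu> r * (1 - \<alpha> r) * z (r-1))"
    by (subst sum.atLeast_Suc_atMost) (use assms(1) in simp_all)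
  also have "\<dots> = (\<Sum>r=1..D. \<mu> (Suc r) * (1 - \<alpha> (Suc r)) * z r)"
    by (subst sum.shift_bounds_cl_Suc_ivl) simp
  also have "\<dots> = (\<Sum>r=1..D. - (\<mu> r * \<alpha> r * z r))"
    by (intro sum.cong refl) (simp add: assms(3))
  finally show ?thesis by (simp add: sum_negf)
qed

text \<open>The range of the matrix is the hyperplane orthogonal to a vector \<open>\<mu>\<close> without zero entries,
  and the best residual is the multiple of the sign vector of \<open>\<mu>\<close> that reaches this hyperplane.\<close>

lemma bidiagonal_best_approximation:
  fixes \<alpha> c :: "nat \<Rightarrow> real"
  assumes a: "\<alpha> 1 = 1" "\<alpha> (Suc D) = 0"
    and pos: "\<And>r. r \<in> {1..D} \<Longrightarrow> 0 < \<alpha> r" "\<And>r. r \<in> {1..D} \<Longrightarrow> \<alpha> (Suc r) < 1"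
  obtains z E where "\<And>r. r \<in> {1..Suc D} \<Longrightarrow> \<bar>c r - (\<alpha> r * z r + (1 - \<alpha> r) * z (r-1))\<bar> = E"
    and "\<And>y. \<exists>r\<in>{1..Suc D}. E \<le> \<bar>c r - (\<alpha> r * y r + (1 - \<alpha> r) * y (r-1))\<bar>"
proof -
  \<comment> \<open>The recursion solves the null vector equations row by row; the case
    \<open>r = 0\<close> sets the free value at index 1.\<close>
  define \<mu> :: "nat \<Rightarrow> real" where
    "\<mu> = rec_nat 1 (\<lambda>r v. if r = 0 then 1 else - v * \<alpha> r / (1 - \<alpha> (Suc r)))"
  have \<mu>_Suc: "\<mu> (Suc r) * (1 - \<alpha> (Suc r)) = - \<mu> r * \<alpha> r" if "r \<in> {1..D}" for r
    using pos(2)[OF that] that by (auto simp: \<mu>_def field_simps)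
  have \<mu>1: "\<mu> 1 = 1" by (simp add: \<mu>_def)
  have \<mu>_nz: "r \<in> {1..Suc D} \<Longrightarrow> \<mu> r \<noteq> 0" for r
  proof (induction r)
    case (Suc r)
    show ?case
    proof (cases "r = 0")
      case False
      then have r: "r \<in> {1..D}" using Suc.prems by auto
      with Suc have "\<mu> r * \<alpha> r \<noteq> 0" using pos(1)[OF r] by auto
      then show ?thesis using \<mu>_Suc[OF r] by auto
    qed (use \<mu>1 in simp)
  qed simp
  note ann = bidiagonal_annihilator[of \<alpha> D \<mu>, OF a \<mu>_Suc]
  define g where "g z r = \<alpha> r * z r + (1 - \<alpha> r) * z (r-1)" for z :: "nat \<Rightarrow> real" and r
  define S where "S = (\<Sum>r=1..Suc D. \<bar>\<mu> r\<bar>)"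
  have S: "S > 0" unfolding S_def by (rule sum_pos) (use \<mu>_nz in auto)
  \<comment> \<open>All residuals have the same pairing with \<mu>; one of constant modulus with the
    signs of \<mu> (or all opposite) must then have modulus \<open>\<bar>E\<bar>\<close>.\<close>
  define E where "E = (\<Sum>r=1..Suc D. \<mu> r * c r) / S"
  have dual: "(\<Sum>r=1..Suc D. \<mu> r * (c r - g y r)) = E * S" for y
    using ann[of y] S by (simp add: right_diff_distrib sum_subtractf E_def g_def del: sum.cl_ivl_Suc)
  \<comment> \<open>Forward substitution prescribes the first \<open>D\<close> residuals; the last
    one is then forced by the pairing with \<mu>.\<close>
  define z :: "nat \<Rightarrow> real" where
    "z = rec_nat 0 (\<lambda>r v. (c (Suc r) - E * sgn (\<mu> (Suc r)) - (1 - \<alpha> (Suc r)) * v) / \<alpha> (Suc r))"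
  have z: "c r - g z r = E * sgn (\<mu> r)" if r: "r \<in> {1..D}" for r
  proof -
    obtain q where q: "r = Suc q" using r by (cases r) auto
    have "z r * \<alpha> r = c r - E * sgn (\<mu> r) - (1 - \<alpha> r) * z (r-1)"
      using pos(1)[OF r] unfolding q by (simp add: z_def)
    then show ?thesis by (simp add: g_def algebra_simps)
  qed
  have "(\<Sum>r=1..Suc D. \<mu> r * (E * sgn (\<mu> r))) = E * S"
    unfolding S_def sum_distrib_left by (intro sum.cong refl) (simp add: abs_sgn)
  with dual[of z] have "(\<Sum>r=1..Suc D. \<mu> r * (c r - g z r)) = (\<Sum>r=1..Suc D. \<mu> r * (E * sgn (\<mu> r)))"
    by simp
  moreover have "(\<Sum>r=1..D. \<mu> r * (c r - g z r)) = (\<Sum>r=1..D. \<mu> r * (E * sgn (\<mu> r)))"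
    by (intro sum.cong refl) (simp add: z)
  ultimately have "c (Suc D) - g z (Suc D) = E * sgn (\<mu> (Suc D))"
    using \<mu>_nz[of "Suc D"] by simp
  with z have z': "c r - g z r = E * sgn (\<mu> r)" if "r \<in> {1..Suc D}" for r
    using that by (cases "r = Suc D") auto
  have 1: "\<bar>c r - g z r\<bar> = \<bar>E\<bar>" if "r \<in> {1..Suc D}" for r
    using \<mu>_nz[OF that] unfolding z'[OF that] by (simp add: abs_mult abs_sgn_eq)
  \<comment> \<open>Hoelder's inequality: residuals all below \<open>\<bar>E\<bar>\<close> would
    have too small a pairing with \<mu>.\<close>
  have 2: "\<exists>r\<in>{1..Suc D}. \<bar>E\<bar> \<le> \<bar>c r - g y r\<bar>" for y
  proof (rule ccontr)
    assume "\<not> ?thesis"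
    then have lt: "\<bar>c r - g y r\<bar> < \<bar>E\<bar>" if "r \<in> {1..Suc D}" for r using that by (meson not_le)
    have "\<bar>E\<bar> * S = \<bar>\<Sum>r=1..Suc D. \<mu> r * (c r - g y r)\<bar>"
      unfolding dual using S by (simp add: abs_mult)
    also have "\<dots> \<le> (\<Sum>r=1..Suc D. \<bar>\<mu> r\<bar> * \<bar>c r - g y r\<bar>)"
      by (rule order_trans[OF sum_abs]) (simp add: abs_mult)
    also have "\<dots> < (\<Sum>r=1..Suc D. \<bar>\<mu> r\<bar> * \<bar>E\<bar>)"
      by (rule sum_strict_mono) (use \<mu>_nz lt in auto)
    also have "\<dots> = \<bar>E\<bar> * S" by (simp add: S_def sum_distrib_left mult.commute del: sum.cl_ivl_Suc)
    finally show False by simp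
  qed
  show ?thesis
    by (rule that[of z "\<bar>E\<bar>"]) (use 1 2 in \<open>auto simp: g_def\<close>)
qed

lemma c_loc_nth:
  assumes "r \<in> {1..p+2-l}" "p + 2 \<le> i" "l \<le> p"
  shows "(c_loc p i l c)\<langle>r\<rangle> = c\<langle>i + r - (p + 2)\<rangle>"
proof -
  have "r - 1 < length [i - p - 1..<i - l + 1]" "[i - p - 1..<i - l + 1] ! (r - 1) = i + r - (p + 2)"
    using assms by (auto simp del: upt_Suc)
  then show ?thesis by (simp add: c_loc_def del: upt_Suc)
qed

text \<open>The range checks disappear because the entries 0 and \<open>Suc D\<close> of
  \<open>z\<close> get the factors \<open>1 - alpha = 0\<close> in row 1 and
  \<open>alpha = 0\<close> in the last row.\<close>

lemma sum_A_loc: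
  assumes "alpha p \<Xi> i 1 = 1" "alpha p \<Xi> i (Suc D) = 0" "r \<in> {1..Suc D}"
  shows "(\<Sum>t=1..D. A_loc p \<Xi> i r t * z t) = alpha p \<Xi> i r * z r + (1 - alpha p \<Xi> i r) * z (r-1)"
proof -
  have "(\<Sum>t=1..D. A_loc p \<Xi> i r t * z t) =
     (\<Sum>t=1..D. (if t = r then alpha p \<Xi> i r * z t else 0) +
       (if t = r - 1 then (1 - alpha p \<Xi> i r) * z t else 0))"
    using assms(3) by (intro sum.cong refl) (auto simp: A_loc_def)
  also have "\<dots> = (if r \<in> {1..D} then alpha p \<Xi> i r * z r else 0) +
       (if r - 1 \<in> {1..D} then (1 - alpha p \<Xi> i r) * z (r-1) else 0)"
    by (simp only: sum.distrib sum.delta finite_atLeastAtMost)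
  also have "(if r \<in> {1..D} then alpha p \<Xi> i r * z r else 0) = alpha p \<Xi> i r * z r"
    using assms by (cases "r = Suc D") auto
  also have "(if r - 1 \<in> {1..D} then (1 - alpha p \<Xi> i r) * z (r-1) else 0) = (1 - alpha p \<Xi> i r) * z (r-1)"
    using assms by (cases "r = 1") auto
  finally show ?thesis .
qed

lemma spline_diff:
  assumes "\<And>i. i \<in> {1..spline_dim p \<Xi>} \<Longrightarrow> e\<langle>i\<rangle> = c\<langle>i\<rangle> - d\<langle>i\<rangle>"
  shows "spline p \<Xi> c x - spline p \<Xi> d x = spline p \<Xi> e x"
  unfolding spline_def sum_subtractf[symmetric]
  by (intro sum.cong refl) (simp add: assms[simplified] left_diff_distrib)

lemma map_upt_nth1: "i \<in> {1..M} \<Longrightarrow> (map f [1..<M+1])\<langle>i\<rangle> = f i"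
  by (auto simp del: upt_Suc)

section \<open>The local problem at one breakpoint, as a block of knot insertion\<close>

context knot_vector
begin

context
  fixes j i l
  assumes j: "j \<in> {2..N-1}"
  defines "i \<equiv> last_knot_index p \<Xi> j" and "l \<equiv> knot_mult p \<Xi> j - 1"
begin

text \<open>The last knot before the breakpoint, which itself occupies the \<open>l + 1\<close>
  indices \<open>k+1\<close> to \<open>i\<close>.\<close>

private definition "k \<equiv> KZ (j-1)"

private lemma ik: "i = KZ j" "l \<le> p" "i = k + l + 1" "p + 1 \<le> k" "i \<le> n"
proof -
  note ij = interior_index[OF j]
  show i: "i = KZ j" unfolding i_def by (rule last_knot_index_eq[OF ij(2)])
  show k: "p + 1 \<le> k" using KZ(1)[OF ij(1)] by (simp add: k_def)
  show n: "i \<le> n" using KZ(1)[OF ij(2)] i by simp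
  show ikl: "i = k + l + 1"
    using ij(6) unfolding i l_def knot_mult_eq[OF j] k_def by simp
  show "l \<le> p"
  proof (rule ccontr)
    assume "\<not> l \<le> p"
    then have *: "k + 1 + p + 1 \<le> i" using ikl by simp
    have "t (k + 1) < t (k + 1 + p + 1)" using * n by (intro mult) auto
    moreover have "t s = Z\<langle>j\<rangle>" if "s \<in> {k+1..i}" for s
      by (rule t_between[OF j]) (use that in \<open>simp only: k_def i\<close>)
    then have "t (k + 1) = Z\<langle>j\<rangle>" "t (k + 1 + p + 1) = Z\<langle>j\<rangle>" using * by auto
    ultimately show False by simp
  qed
qed

private lemma t_i:
  "s \<le> k \<Longrightarrow> t s < t i" "k < s \<Longrightarrow> s \<le> i \<Longrightarrow> t s = t i" "i < s \<Longrightarrow> t i < t s"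
proof -
  note ij = interior_index[OF j]
  have i: "t i = Z\<langle>j\<rangle>" using KZ(2)[OF ij(2)] ik(1) by simp
  show "t s < t i" if "s \<le> k" using monoD[OF mono_t that] ij(7) i by (simp add: k_def)
  show "t s = t i" if "k < s" "s \<le> i"
    unfolding i by (rule t_between[OF j]) (use that ik(1) in \<open>auto simp: k_def\<close>)
  show "t i < t s" if "i < s" using monoD[OF mono_t, of "Suc i" s] that ij(8) i ik(1) by simp
qed

lemma removal_index: "i \<in> {p+2..n}" "l \<le> p"
  using ik by auto

private lemma alpha_eq:
  assumes "r \<in> {1..p+2-l}"
  shows "alpha p \<Xi> i r = (t i - t (i+r-(p+2))) / (t (i+r-1) - t (i+r-(p+2)))"
proof -
  have "i \<le> length \<Xi>" "i+r-(p+2) \<le> length \<Xi>" "i+r-1 \<le> length \<Xi>" using assms ik n by auto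
  then show ?thesis by (simp add: alpha_def knot_eq)
qed

text \<open>The window of rows is cut to fit: the upper knot of row 1 is \<open>t i\<close>, and the
  lower knot of the last row is \<open>t (k+1) = t i\<close>. Lower knots of earlier rows are below
  \<open>t i\<close>, upper knots of later rows above it.\<close>

private lemma alpha_props:
  "alpha p \<Xi> i 1 = 1" "alpha p \<Xi> i (Suc (p+1-l)) = 0"
  "\<And>r. r \<in> {1..p+1-l} \<Longrightarrow> 0 < alpha p \<Xi> i r"
  "\<And>r. r \<in> {1..p+1-l} \<Longrightarrow> alpha p \<Xi> i (Suc r) < 1"
proof -
  have "t (i + 1 - (p+2)) < t i" using ik by (intro t_i) auto
  then show "alpha p \<Xi> i 1 = 1" using ik by (subst alpha_eq) auto
  have "i + Suc (p+1-l) - (p+2) = k + 1" using ik by auto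
  moreover have "t (k + 1) = t i" using ik by (intro t_i) auto
  ultimately show "alpha p \<Xi> i (Suc (p+1-l)) = 0" using ik by (subst alpha_eq) auto
  fix r assume r: "r \<in> {1..p+1-l}"
  have "t (i + r - (p+2)) < t i" using ik r by (intro t_i) auto
  moreover have "t i \<le> t (i + r - 1)" using r by (intro monoD[OF mono_t]) auto
  ultimately show "0 < alpha p \<Xi> i r" using r by (subst alpha_eq) auto
  have "t (i + Suc r - (p+2)) \<le> t i" using ik r by (intro monoD[OF mono_t]) auto
  moreover have "t i < t (i + Suc r - 1)" using ik r by (intro t_i) auto
  ultimately show "alpha p \<Xi> i (Suc r) < 1" using r by (subst alpha_eq) (auto simp: field_simps)
qed

text \<open>Identifies the local matrix as a block of Boehm's. Row \<open>p + 2\<close> exists only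
  for \<open>l = 0\<close>; its index is \<open>i\<close>, where the insertion coefficient is 0 by
  definition.\<close>

private lemma alpha_ins_coeff:
  assumes r: "r \<in> {1..p+2-l}"
  shows "ins_coeff t p i (i+r-(p+2)) = alpha p \<Xi> i r"
proof -
  consider "r = 1" | "r = p + 2" "l = 0" | "r \<in> {2..p+1}" using r by force
  then show ?thesis
  proof cases
    case 1
    then show ?thesis using alpha_props(1) ik by (simp add: ins_coeff_def)
  next
    case 2
    then show ?thesis using alpha_props(2) by (simp add: ins_coeff_def)
  next
    case 3
    then have "i + r - (p+2) + p + 1 = i + r - 1" "\<not> i + r - (p+2) + p < i" "\<not> i \<le> i + r - (p+2)"
      using ik by auto
    then show ?thesis unfolding alpha_eq[OF r] ins_coeff_def by (simp only: if_False)
  qed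
qed

text \<open>Since the knots \<open>k+1\<close> to \<open>i\<close> coincide, insertion is a pure
  shift already from index \<open>k+1 = i - l\<close> on. This is why the local block is shortened
  by \<open>l\<close>.\<close>

private lemma ins_coeff_right:
  assumes "k < s" shows "ins_coeff t p i s = 0"
proof (cases "i \<le> s")
  case False
  with t_i(2)[of s] assms ik show ?thesis by (auto simp: ins_coeff_def)
qed (simp add: ins_coeff_def)

lemma loc_residual_eq:
  assumes d: "\<And>r. r \<in> {1..p+1-l} \<Longrightarrow> z\<langle>r\<rangle> = d\<langle>i+r-(p+2)\<rangle>"
  shows "loc_residual p \<Xi> i l c z =
     (MAX r\<in>{1..p+2-l}. \<bar>c\<langle>i+r-(p+2)\<rangle> - (insert_knot_coeffs p \<Xi> i d)\<langle>i+r-(p+2)\<rangle>\<bar>)"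
proof -
  have "(c_loc p i l c)\<langle>r\<rangle> - (\<Sum>t=1..p+1-l. A_loc p \<Xi> i r t * z\<langle>t\<rangle>) =
     c\<langle>i+r-(p+2)\<rangle> - (insert_knot_coeffs p \<Xi> i d)\<langle>i+r-(p+2)\<rangle>" if r: "r \<in> {1..p+2-l}" for r
  proof -
    have r': "r \<in> {1..Suc (p+1-l)}" using r by auto
    have s: "i+r-(p+2) \<in> {1..n}" using r ik by auto
    have "(\<Sum>t=1..p+1-l. A_loc p \<Xi> i r t * z\<langle>t\<rangle>) = (\<Sum>t=1..p+1-l. A_loc p \<Xi> i r t * d\<langle>i+t-(p+2)\<rangle>)"
      by (intro sum.cong refl) (simp only: d)
    also have "\<dots> = alpha p \<Xi> i r * d\<langle>i+r-(p+2)\<rangle> + (1 - alpha p \<Xi> i r) * d\<langle>i+(r-1)-(p+2)\<rangle>"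
      by (rule sum_A_loc[OF alpha_props(1,2) r'])
    also have "i+(r-1)-(p+2) = i+r-(p+2)-1" using r ik by auto
    finally show ?thesis
      using c_loc_nth[OF r, of i c] ik insert_knot_coeffs_nth[OF s] alpha_ins_coeff[OF r] by simp
  qed
  then show ?thesis unfolding loc_residual_def
    by (intro arg_cong[of _ _ Max] image_cong) auto
qed

text \<open>Keeps the loop from getting stuck. The optimal function is stored as a list; its values
  at 0 and \<open>Suc (p+1-l)\<close>, which the list lacks, have coefficient zero.\<close>

lemma ex_minimizer: "\<exists>z. is_arg_min (loc_residual p \<Xi> i l c) (\<lambda>z. length z = p+1-l) z"
proof -
  define g where "g z r = alpha p \<Xi> i r * z r + (1 - alpha p \<Xi> i r) * z (r-1)" for z :: "nat \<Rightarrow> real" and r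
  obtain z E where z: "\<And>r. r \<in> {1..Suc (p+1-l)} \<Longrightarrow> \<bar>(c_loc p i l c)\<langle>r\<rangle> - g z r\<bar> = E"
    and E: "\<And>y. \<exists>r\<in>{1..Suc (p+1-l)}. E \<le> \<bar>(c_loc p i l c)\<langle>r\<rangle> - g y r\<bar>"
    using bidiagonal_best_approximation[OF alpha_props, of "\<lambda>r. (c_loc p i l c)\<langle>r\<rangle>"] unfolding g_def by blast
  have D: "p + 2 - l = Suc (p+1-l)" using ik by simp
  have res: "loc_residual p \<Xi> i l c y = (MAX r\<in>{1..Suc (p+1-l)}. \<bar>(c_loc p i l c)\<langle>r\<rangle> - g (\<lambda>t. y\<langle>t\<rangle>) r\<bar>)" for y
    unfolding loc_residual_def D g_def
    by (intro arg_cong[of _ _ Max] image_cong refl) (simp only: sum_A_loc[OF alpha_props(1,2)])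
  define zl where "zl = map z [1..<(p+1-l)+1]"
  have gz: "g (\<lambda>t. zl\<langle>t\<rangle>) r = g z r" if r: "r \<in> {1..Suc (p+1-l)}" for r
  proof -
    have "alpha p \<Xi> i r * zl\<langle>r\<rangle> = alpha p \<Xi> i r * z r"
      using r alpha_props(2) map_upt_nth1[of r "p+1-l" z] by (cases "r = Suc (p+1-l)") (auto simp: zl_def simp del: upt_Suc)
    moreover have "(1 - alpha p \<Xi> i r) * zl\<langle>r-1\<rangle> = (1 - alpha p \<Xi> i r) * z (r-1)"
    proof (cases "r = 1")
      case False
      then have "r - 1 \<in> {1..p+1-l}" using r by auto
      from map_upt_nth1[OF this, of z] show ?thesis by (simp only: zl_def)
    qed (use alpha_props(1) in simp)
    ultimately show ?thesis by (simp only: g_def)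
  qed
  have le: "loc_residual p \<Xi> i l c zl \<le> E"
    unfolding res by (subst Max_le_iff) (use z gz in auto)
  have ge: "E \<le> loc_residual p \<Xi> i l c y" for y
  proof -
    obtain r where "r \<in> {1..Suc (p+1-l)}" "E \<le> \<bar>(c_loc p i l c)\<langle>r\<rangle> - g (\<lambda>t. y\<langle>t\<rangle>) r\<bar>" using E by blast
    then show ?thesis unfolding res by (subst Max_ge_iff) auto
  qed
  have "length zl = p+1-l" unfolding zl_def length_map length_upt by simp
  moreover have "loc_residual p \<Xi> i l c zl \<le> loc_residual p \<Xi> i l c y" for y
    using le ge[of y] by simp
  ultimately have "is_arg_min (loc_residual p \<Xi> i l c) (\<lambda>z. length z = p+1-l) zl"
    unfolding is_arg_min_linorder by blast
  then show ?thesis by blast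
qed

interpretation R: knot_vector p "remove_index i \<Xi>"
  by (rule knot_vector_removed[OF removal_index(1)])

text \<open>Every \<open>g\<close> in the smaller space has coefficients \<open>d\<close>, and the
  block of \<open>d\<close> competes with \<open>z\<close>. Its residual is a maximum over part of
  the control points of \<open>s - g\<close>, so the minimal residual is a lower bound of the
  infimum.\<close>

lemma residual_le_knot_removal_error:
  assumes c: "length c = n" and z: "is_arg_min (loc_residual p \<Xi> i l c) (\<lambda>z. length z = p+1-l) z"
  shows "loc_residual p \<Xi> i l c z \<le> knot_removal_error p \<Xi> j (spline p \<Xi> c)"
  unfolding knot_removal_error_def i_def[symmetric]
proof (rule cINF_greatest)
  show "spline_space_of_knots p (remove_index i \<Xi>) \<noteq> {}" using R.spline_in_spline_space by blast
  fix g assume "g \<in> spline_space_of_knots p (remove_index i \<Xi>)"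
  from R.spline_space_coeffs[OF this] removed_ends[OF removal_index(1)]
  obtain d where d: "\<And>x. x \<in> {t (p+1)..t (n+1)} \<Longrightarrow> g x = spline p (remove_index i \<Xi>) d x" by auto
  define e where "e = map (\<lambda>s. c\<langle>s\<rangle> - (insert_knot_coeffs p \<Xi> i d)\<langle>s\<rangle>) [1..<n+1]"
  have e: "e\<langle>s\<rangle> = c\<langle>s\<rangle> - (insert_knot_coeffs p \<Xi> i d)\<langle>s\<rangle>" if "s \<in> {1..n}" for s
    unfolding e_def by (rule map_upt_nth1[OF that])
  have "control_points p \<Xi> (\<lambda>x. spline p \<Xi> c x - g x) = e"
  proof (rule control_points_eq)
    show "length e = n" by (simp add: e_def)
    fix x assume x: "x \<in> {t (p+1)..t (n+1)}"
    show "spline p \<Xi> c x - g x = spline p \<Xi> e x"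
      unfolding d[OF x] knot_insertion[OF removal_index(1) x] by (rule spline_diff[OF e])
  qed
  then have cp: "cp_norm p \<Xi> (\<lambda>x. spline p \<Xi> c x - g x) = (MAX s\<in>{1..n}. \<bar>e\<langle>s\<rangle>\<bar>)"
    by (simp add: cp_norm_def)
  define y where "y = map (\<lambda>r. d\<langle>i+r-(p+2)\<rangle>) [1..<(p+1-l)+1]"
  have "loc_residual p \<Xi> i l c z \<le> loc_residual p \<Xi> i l c y"
    using z by (auto simp: is_arg_min_linorder y_def)
  also have "\<dots> = (MAX r\<in>{1..p+2-l}. \<bar>c\<langle>i+r-(p+2)\<rangle> - (insert_knot_coeffs p \<Xi> i d)\<langle>i+r-(p+2)\<rangle>\<bar>)"
    by (rule loc_residual_eq) (unfold y_def, rule map_upt_nth1)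
  also have "\<dots> \<le> (MAX s\<in>{1..n}. \<bar>e\<langle>s\<rangle>\<bar>)"
  proof (rule Max_mono)
    show "(\<lambda>r. \<bar>c\<langle>i+r-(p+2)\<rangle> - (insert_knot_coeffs p \<Xi> i d)\<langle>i+r-(p+2)\<rangle>\<bar>) ` {1..p+2-l}
       \<subseteq> (\<lambda>s. \<bar>e\<langle>s\<rangle>\<bar>) ` {1..n}"
    proof (rule image_subsetI)
      fix r assume "r \<in> {1..p+2-l}"
      then have s: "i+r-(p+2) \<in> {1..n}" using ik by auto
      show "\<bar>c\<langle>i+r-(p+2)\<rangle> - (insert_knot_coeffs p \<Xi> i d)\<langle>i+r-(p+2)\<rangle>\<bar> \<in> (\<lambda>s. \<bar>e\<langle>s\<rangle>\<bar>) ` {1..n}"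
        by (rule image_eqI[OF _ s]) (simp only: e[OF s])
    qed
  qed (use ik in auto)
  finally show "loc_residual p \<Xi> i l c z \<le> cp_norm p \<Xi> (\<lambda>x. spline p \<Xi> c x - g x)"
    unfolding cp .
qed

lemma removal_step:
  assumes c: "length c = n" and z: "length z = p+1-l"
  defines "c' \<equiv> take (i - p - 2) c @ z @ drop (i - l) c"
  shows "length c' = R.n"
    and "x \<in> {t (p+1)..t (n+1)} \<Longrightarrow>
      \<bar>spline p \<Xi> c x - spline p (remove_index i \<Xi>) c' x\<bar> \<le> loc_residual p \<Xi> i l c z"
proof -
  show "length c' = R.n"
    using c z ik unfolding c'_def dim_removed[OF removal_index(1)] by auto
  have len: "length (take (i - p - 2) c) = i - p - 2" using c ik by auto
  have c'1: "c'\<langle>s\<rangle> = c\<langle>s\<rangle>" if "s \<in> {1..i-p-2}" for s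
    using that len by (auto simp: c'_def nth_append)
  have c'_nth: "c' ! (i - p - 2 + q) = (z @ drop (i - l) c) ! q" for q
    using nth_append_length_plus[of "take (i - p - 2) c" "z @ drop (i - l) c" q]
    unfolding len c'_def .
  have c'2: "c'\<langle>i+r-(p+2)\<rangle> = z\<langle>r\<rangle>" if "r \<in> {1..p+1-l}" for r
  proof -
    have "i + r - (p+2) - 1 = (i-p-2) + (r-1)" using that ik by auto
    then have "c'\<langle>i+r-(p+2)\<rangle> = (z @ drop (i - l) c) ! (r - 1)" by (simp only: c'_nth)
    also have "\<dots> = z\<langle>r\<rangle>" unfolding nth_append using that z by auto
    finally show ?thesis .
  qed
  have c'3: "c'\<langle>s-1\<rangle> = c\<langle>s\<rangle>" if s: "s \<in> {i-l+1..n}" for s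
  proof -
    have "s - 1 - 1 = (i-p-2) + ((p+1-l) + (s - 1 - (i - l)))" using s ik by auto
    then have "c'\<langle>s-1\<rangle> = drop (i-l) c ! (s - 1 - (i - l))"
      unfolding z[symmetric] by (simp only: c'_nth nth_append_length_plus)
    also have "\<dots> = c\<langle>s\<rangle>" using s c by auto
    finally show ?thesis .
  qed
  define e where "e = map (\<lambda>s. c\<langle>s\<rangle> - (insert_knot_coeffs p \<Xi> i c')\<langle>s\<rangle>) [1..<n+1]"
  have e: "e\<langle>s\<rangle> = c\<langle>s\<rangle> - (insert_knot_coeffs p \<Xi> i c')\<langle>s\<rangle>" if "s \<in> {1..n}" for s
    unfolding e_def by (rule map_upt_nth1[OF that])
  have res: "loc_residual p \<Xi> i l c z =
     (MAX r\<in>{1..p+2-l}. \<bar>c\<langle>i+r-(p+2)\<rangle> - (insert_knot_coeffs p \<Xi> i c')\<langle>i+r-(p+2)\<rangle>\<bar>)"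
    by (rule loc_residual_eq) (simp only: c'2)
  have res_ge: "\<bar>c\<langle>i+r-(p+2)\<rangle> - (insert_knot_coeffs p \<Xi> i c')\<langle>i+r-(p+2)\<rangle>\<bar> \<le> loc_residual p \<Xi> i l c z"
    if "r \<in> {1..p+2-l}" for r
    unfolding res using that by (intro Max_ge imageI) auto
  from res_ge[of 1] ik have nonneg: "0 \<le> loc_residual p \<Xi> i l c z" by fastforce
  have e_le: "\<bar>e\<langle>s\<rangle>\<bar> \<le> loc_residual p \<Xi> i l c z" if s: "s \<in> {1..n}" for s
  proof -
    \<comment> \<open>Before the block insertion copies \<open>c'\<close>, after it insertion shifts
      \<open>c'\<close> by one; both recover \<open>c\<close>, so only the block carries an
      error.\<close>
    consider "s \<le> i - p - 2" | "i - l + 1 \<le> s" | "i - p - 1 \<le> s" "s \<le> i - l" by linarith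
    then show ?thesis
    proof cases
      case 1
      then have "ins_coeff t p i s = 1" using s ik by (auto simp: ins_coeff_def)
      then show ?thesis unfolding e[OF s] insert_knot_coeffs_nth[OF s]
        using nonneg c'1[of s] 1 s by simp
    next
      case 2
      then have "ins_coeff t p i s = 0" using ik by (intro ins_coeff_right) auto
      then show ?thesis unfolding e[OF s] insert_knot_coeffs_nth[OF s]
        using nonneg c'3[of s] 2 s by simp
    next
      case 3
      define r where "r = s + (p+2) - i"
      have r: "r \<in> {1..p+2-l}" "i + r - (p+2) = s" using 3 s ik(2-5) unfolding r_def atLeastAtMost_iff by arith+
      show ?thesis using res_ge[OF r(1)] unfolding r(2) e[OF s] .
    qed
  qed
  show "\<bar>spline p \<Xi> c x - spline p (remove_index i \<Xi>) c' x\<bar> \<le> loc_residual p \<Xi> i l c z"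
    if x: "x \<in> {t (p+1)..t (n+1)}"
  proof -
    have "spline p \<Xi> c x - spline p (remove_index i \<Xi>) c' x = spline p \<Xi> e x"
      unfolding knot_insertion[OF removal_index(1) x] by (rule spline_diff[OF e])
    then show ?thesis using abs_spline_le[OF x e_le] by simp
  qed
qed

end

end

section \<open>Measurability and the essential supremum\<close>

lemma borel_measurable_cox_de_boor [measurable]: "cox_de_boor \<Xi> b q i \<in> borel_measurable borel"
proof (induction q arbitrary: i)
  case 0
  show ?case unfolding cox_de_boor.simps by measurable
next
  case (Suc q)
  note [measurable] = Suc
  show ?case unfolding cox_de_boor.simps by measurable
qed

lemma borel_measurable_spline: "spline p \<Xi> c \<in> borel_measurable borel"
  unfolding spline_def bspline_def by measurable

text \<open>The essential supremum is bounded only for measurable functions, while a spline is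
  arbitrary outside \<open>[a, b]\<close>; the Borel function \<open>g\<close> stands in for
  \<open>f\<close> on the interval.\<close>

lemma Linf_norm_le:
  assumes "\<And>x. x \<in> {a..b} \<Longrightarrow> \<bar>f x\<bar> \<le> M" "\<And>x. x \<in> {a..b} \<Longrightarrow> f x = g x"
    and [measurable]: "g \<in> borel_measurable borel"
  shows "Linf_norm a b f \<le> ereal M"
  unfolding Linf_norm_def
proof (rule esssup_I)
  have "(\<lambda>x. ereal \<bar>g x\<bar>) \<in> borel_measurable lborel" by measurable
  then have "(\<lambda>x. ereal \<bar>g x\<bar>) \<in> borel_measurable (lebesgue_on {a..b})"
    by (intro measurable_restrict_space1 measurable_completion)
  moreover have "(\<lambda>x. ereal \<bar>f x\<bar>) \<in> borel_measurable (lebesgue_on {a..b}) \<longleftrightarrow>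
      (\<lambda>x. ereal \<bar>g x\<bar>) \<in> borel_measurable (lebesgue_on {a..b})"
    by (rule measurable_cong) (simp add: assms(2))
  ultimately show "(\<lambda>x. ereal \<bar>f x\<bar>) \<in> borel_measurable (lebesgue_on {a..b})" by blast
  show "AE x in lebesgue_on {a..b}. ereal \<bar>f x\<bar> \<le> ereal M"
    by (rule AE_I2) (use assms(1) in simp)
qed

section \<open>The given data as a knot vector\<close>

lemma sorted_concat_replicate:
  "sorted (map f js) \<Longrightarrow> sorted (concat (map (\<lambda>j. replicate (m j) (f j)) js))"
  by (induction js) (auto simp: sorted_append)

lemma count_list_replicate: "count_list (replicate k x) y = (if x = y then k else 0)"
  by (induction k) auto

lemma count_concat_replicate:
  assumes "distinct js" "inj_on f (set js)" "j \<in> set js"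
  shows "count_list (concat (map (\<lambda>j. replicate (m j) (f j)) js)) (f j) = m j"
  using assms
proof (induction js)
  case (Cons a js)
  have *: "count_list (concat (map (\<lambda>j. replicate (m j) (f j)) js)) (f a) = 0"
    using Cons.prems by (auto intro!: count_notin simp: inj_on_def)
  show ?case
  proof (cases "j = a")
    case False
    then have "f a \<noteq> f j" using Cons.prems by (auto simp: inj_on_def)
    then show ?thesis using False Cons by (simp add: count_list_replicate)
  qed (simp add: * count_list_replicate)
qed simp

text \<open>Links the given breakpoints and multiplicities to those recovered from the vector.
  Interior breakpoints lie strictly between the ends, so the auxiliary knots do not disturb the
  counting.\<close>

lemma basic_knot_vector:
  assumes \<zeta>: "length \<zeta> \<ge> 2" "sorted_wrt (<) \<zeta>"
    and m: "\<forall>j\<in>{2..length \<zeta> - 1}. 1 \<le> m j \<and> m j \<le> p + 1"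
    and basic: "basic_knot_vector p \<zeta> m \<Xi>"
  shows "knot_vector p \<Xi>" and "breakpoints p \<Xi> = \<zeta>"
    and "\<And>j. j \<in> {2..length \<zeta> - 1} \<Longrightarrow> knot_mult p \<Xi> j = m j"
    and "knot \<Xi> (p+1) = hd \<zeta>" and "knot \<Xi> (spline_dim p \<Xi> + 1) = last \<zeta>"
proof -
  define a where "a = hd \<zeta>"
  define b where "b = last \<zeta>"
  define M where "M = concat (map (\<lambda>j. replicate (m j) (\<zeta>\<langle>j\<rangle>)) [2..<length \<zeta>])"
  obtain L R where LR: "\<Xi> = L @ M @ R" "length L = p + 1" "sorted L" "last L = a"
    "length R = p + 1" "sorted R" "hd R = b"
    using basic unfolding basic_knot_vector_def a_def b_def M_def by blast
  define L' where "L' = butlast L"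
  define R' where "R' = tl R"
  have L: "L = L' @ [a]" and L': "length L' = p" using LR by (auto simp: L'_def intro!: append_butlast_last_id[symmetric])
  have R: "R = b # R'" and R': "length R' = p" using LR by (auto simp: R'_def intro!: hd_Cons_tl[symmetric])
  have \<Xi>: "\<Xi> = L' @ (a # M @ [b]) @ R'" using LR L R by simp
  have less: "\<zeta>\<langle>i\<rangle> < \<zeta>\<langle>j\<rangle>" if "1 \<le> i" "i < j" "j \<le> length \<zeta>" for i j
    using that \<zeta>(2) by (auto simp: sorted_wrt_iff_nth_less)
  have ab: "a = \<zeta>\<langle>1\<rangle>" "b = \<zeta>\<langle>length \<zeta>\<rangle>" using \<zeta>(1) by (cases \<zeta>; auto simp: a_def b_def hd_conv_nth last_conv_nth)+
  have between: "a < \<zeta>\<langle>j\<rangle> \<and> \<zeta>\<langle>j\<rangle> < b" if "j \<in> {2..length \<zeta> - 1}" for j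
    unfolding ab by (intro conjI less) (use that in auto)
  have a_b: "a < b" unfolding ab by (rule less) (use \<zeta> in auto)
  have setM: "set M = (\<lambda>j. \<zeta>\<langle>j\<rangle>) ` {2..length \<zeta> - 1}"
  proof -
    have "set M = (\<Union>j\<in>{2..<length \<zeta>}. set (replicate (m j) (\<zeta>\<langle>j\<rangle>)))"
      by (simp add: M_def)
    also have "\<dots> = (\<Union>j\<in>{2..length \<zeta> - 1}. {\<zeta>\<langle>j\<rangle>})"
      using m by (intro SUP_cong) (fastforce simp: set_replicate_conv_if)+
    finally show ?thesis by auto
  qed
  have M: "a < v" "v < b" if "v \<in> set M" for v using that between by (auto simp: setM)
  have "sorted (map (\<lambda>j. \<zeta>\<langle>j\<rangle>) [2..<length \<zeta>])"
    unfolding sorted_iff_nth_mono_less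
  proof (intro allI impI)
    fix i j assume "i < j" "j < length (map (\<lambda>j. \<zeta>\<langle>j\<rangle>) [2..<length \<zeta>])"
    moreover from this have "2 + j \<le> length \<zeta>" by auto
    ultimately show "map (\<lambda>j. \<zeta>\<langle>j\<rangle>) [2..<length \<zeta>] ! i \<le> map (\<lambda>j. \<zeta>\<langle>j\<rangle>) [2..<length \<zeta>] ! j"
      using less[of "2 + i" "2 + j"] by auto
  qed
  then have sM: "sorted M" unfolding M_def by (rule sorted_concat_replicate)
  have sL: "\<forall>v\<in>set L'. v \<le> a" and sR: "\<forall>v\<in>set R'. b \<le> v"
    using LR(3,6) by (auto simp: L R sorted_append)
  have ge_b: "b \<le> y" if "y \<in> set R" for y using that sR by (auto simp: R)
  have le_a: "x \<le> a" if "x \<in> set L" for x using that sL by (auto simp: L)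
  have "x \<le> y" if "x \<in> set M" "y \<in> set R" for x y
    using M(2)[OF that(1)] ge_b[OF that(2)] by simp
  then have "sorted (M @ R)" using sM LR(6) by (simp add: sorted_append)
  moreover have "a \<le> y" if "y \<in> set (M @ R)" for y
    using that M(1)[of y] ge_b[of y] a_b by auto
  then have "x \<le> y" if "x \<in> set L" "y \<in> set (M @ R)" for x y
    using le_a[OF that(1)] that(2) by (meson order_trans)
  ultimately have sorted: "sorted \<Xi>"
    unfolding LR(1) sorted_append[of L] using LR(3) by blast
  have n: "spline_dim p \<Xi> = p + 1 + length M" "length \<Xi> = 2 * p + 2 + length M"
    by (simp_all add: spline_dim_def \<Xi> L' R')
  have mid: "\<Xi> ! (p + q) = (a # M @ [b]) ! q" if "q \<le> length M + 1" for q
    using that nth_append[of "a # M @ [b]" R' q] nth_append_length_plus[of L' "(a # M @ [b]) @ R'" q]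
    unfolding \<Xi> L' by (simp split: if_splits)
  have t_mid: "knot \<Xi> (p + 1 + q) = (a # M @ [b]) ! q" if "q \<le> length M + 1" for q
    using mid[OF that] that n by (simp add: knot_def)
  show ta: "knot \<Xi> (p+1) = hd \<zeta>" using t_mid[of 0] by (simp add: a_def)
  have dim1: "spline_dim p \<Xi> + 1 = p + 1 + (length M + 1)" using n by simp
  show tb: "knot \<Xi> (spline_dim p \<Xi> + 1) = last \<zeta>"
    unfolding dim1 t_mid[OF order_refl] by (simp add: b_def nth_append)
  have "(\<lambda>i. \<Xi>\<langle>i\<rangle>) ` {p+1..spline_dim p \<Xi> + 1} = set (a # M @ [b])"
  proof -
    have "{p+1..spline_dim p \<Xi> + 1} = (\<lambda>q. p + 1 + q) ` {..<length (a # M @ [b])}"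
    proof (intro set_eqI iffI)
      fix i assume "i \<in> {p+1..spline_dim p \<Xi> + 1}"
      then show "i \<in> (\<lambda>q. p + 1 + q) ` {..<length (a # M @ [b])}"
        using n by (intro image_eqI[of _ _ "i - (p+1)"]) auto
    qed (use n in auto)
    then have "(\<lambda>i. \<Xi>\<langle>i\<rangle>) ` {p+1..spline_dim p \<Xi> + 1} = (\<lambda>q. \<Xi> ! (p + q)) ` {..<length (a # M @ [b])}"
      by (simp add: image_image)
    also have "\<dots> = (\<lambda>q. (a # M @ [b]) ! q) ` {..<length (a # M @ [b])}"
      by (intro image_cong refl mid) auto
    also have "\<dots> = set (a # M @ [b])"
      by (auto simp only: set_conv_nth)
    finally show ?thesis .
  qed
  also have "\<dots> = set \<zeta>"
  proof -
    have "set \<zeta> = (\<lambda>j. \<zeta>\<langle>j\<rangle>) ` {1..length \<zeta>}"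
    proof -
      have "{1..length \<zeta>} = Suc ` {..<length \<zeta>}" by (auto simp: image_Suc_lessThan)
      then have "(\<lambda>j. \<zeta>\<langle>j\<rangle>) ` {1..length \<zeta>} = (!) \<zeta> ` {..<length \<zeta>}"
        by (simp add: image_image)
      then show ?thesis by (auto simp: set_conv_nth)
    qed
    also have "{1..length \<zeta>} = insert 1 (insert (length \<zeta>) {2..length \<zeta> - 1})" using \<zeta>(1) by auto
    finally show ?thesis by (auto simp: setM ab)
  qed
  finally have "breakpoints p \<Xi> = sorted_list_of_set (set \<zeta>)"
    by (simp add: breakpoints_def)
  also have "\<dots> = \<zeta>"
    using \<zeta>(2) by (intro sorted_list_of_set.idem_if_sorted_distinct) (auto simp: strict_sorted_iff)
  finally show bp: "breakpoints p \<Xi> = \<zeta>" .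
  have count: "count_list \<Xi> (\<zeta>\<langle>j\<rangle>) = m j" if j: "j \<in> {2..length \<zeta> - 1}" for j
  proof -
    have inj: "inj_on (\<lambda>j. \<zeta>\<langle>j\<rangle>) (set [2..<length \<zeta>])"
    proof (rule linorder_inj_onI)
      fix x y assume "x < y" "x \<in> set [2..<length \<zeta>]" "y \<in> set [2..<length \<zeta>]"
      then have "\<zeta>\<langle>x\<rangle> < \<zeta>\<langle>y\<rangle>" by (intro less) auto
      then show "\<zeta>\<langle>x\<rangle> \<noteq> \<zeta>\<langle>y\<rangle>" by simp
    qed auto
    have "count_list M (\<zeta>\<langle>j\<rangle>) = m j"
      unfolding M_def by (rule count_concat_replicate[OF _ inj]) (use j in auto)
    moreover have "count_list L' (\<zeta>\<langle>j\<rangle>) = 0" "count_list R' (\<zeta>\<langle>j\<rangle>) = 0"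
      using sL sR between[OF j] by (force intro!: count_notin)+
    moreover have "a \<noteq> \<zeta>\<langle>j\<rangle>" "b \<noteq> \<zeta>\<langle>j\<rangle>" using between[OF j] by auto
    ultimately show ?thesis by (simp add: \<Xi>)
  qed
  then show "\<And>j. j \<in> {2..length \<zeta> - 1} \<Longrightarrow> knot_mult p \<Xi> j = m j"
    by (simp add: knot_mult_def bp)
  have mono: "mono (knot \<Xi>)"
  proof (rule monoI)
    fix i j :: nat assume "i \<le> j"
    then show "knot \<Xi> i \<le> knot \<Xi> j"
      unfolding knot_def using n by (intro sorted_nth_mono[OF sorted]) auto
  qed
  have left: "knot \<Xi> (p + 1) < knot \<Xi> (p + 2)"
    using t_mid[of 0] t_mid[of 1] M a_b by (cases M) auto
  have right: "knot \<Xi> (spline_dim p \<Xi>) < knot \<Xi> (spline_dim p \<Xi> + 1)"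
  proof -
    have "knot \<Xi> (spline_dim p \<Xi>) = (a # M) ! length M"
      using t_mid[of "length M"] n by (simp add: nth_append nth_Cons split: nat.splits)
    also have "\<dots> \<in> set (a # M)" by (rule nth_mem) simp
    finally show ?thesis using tb M(2) a_b by (auto simp: b_def)
  qed
  show "knot_vector p \<Xi>"
  proof
    show "knot \<Xi> i < knot \<Xi> (i + p + 1)" if i: "i \<in> {1..spline_dim p \<Xi>}" for i
    proof -
      consider "i \<le> p + 1" | "spline_dim p \<Xi> \<le> i + p" | "p + 1 < i" "i + p < spline_dim p \<Xi>" by linarith
      then show ?thesis
      proof cases
        case 1
        then show ?thesis using left i monoD[OF mono, of i "p+1"] monoD[OF mono, of "p+2" "i+p+1"] by auto
      next
        case 2
        then show ?thesis
          using right i monoD[OF mono, of i "spline_dim p \<Xi>"] monoD[OF mono, of "spline_dim p \<Xi> + 1" "i+p+1"] by auto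
      next
        case 3
        define q where "q = i - (p+2)"
        have q: "i = p + 1 + Suc q" "q < length M" using 3 n by (auto simp: q_def)
        have "knot \<Xi> i = M ! q"
          unfolding q(1) using q(2) by (subst t_mid) (auto simp: nth_append)
        also have "\<dots> \<in> set M" using q(2) by (rule nth_mem)
        finally obtain j where j: "j \<in> {2..length \<zeta> - 1}" "knot \<Xi> i = \<zeta>\<langle>j\<rangle>" by (auto simp: setM)
        show ?thesis
        proof (rule ccontr)
          assume "\<not> ?thesis"
          then have le: "knot \<Xi> (i + p + 1) \<le> knot \<Xi> i" by simp
          \<comment> \<open>These are \<open>p + 2\<close> list positions, counted from 0, all
            holding one interior breakpoint of multiplicity at most \<open>p + 1\<close>.\<close>
          have "{i-1..i+p} \<subseteq> {q. q < length \<Xi> \<and> \<zeta>\<langle>j\<rangle> = \<Xi> ! q}"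
          proof (intro subsetI CollectI conjI)
            fix q assume q: "q \<in> {i-1..i+p}"
            show ql: "q < length \<Xi>" using q 3 n by auto
            have "knot \<Xi> i \<le> knot \<Xi> (Suc q)" "knot \<Xi> (Suc q) \<le> knot \<Xi> (i + p + 1)"
              using q by (auto intro!: monoD[OF mono])
            with le have "knot \<Xi> (Suc q) = knot \<Xi> i" by simp
            then show "\<zeta>\<langle>j\<rangle> = \<Xi> ! q" using j(2) ql by (simp add: knot_eq)
          qed
          from card_mono[OF _ this] have "card {i-1..i+p} \<le> count_list \<Xi> (\<zeta>\<langle>j\<rangle>)"
            by (simp add: count_list_eq_length_filter length_filter_conv_card)
          with count[OF j(1)] bspec[OF m j(1)] 3 show False by auto
        qed
      qed
    qed
  qed (use sorted left right n in auto)
qed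

section \<open>The loop invariant: the error so far is at most the tolerance spent\<close>

theorem theorem4p3:
  fixes p :: nat and \<zeta> :: "real list" and m :: "nat \<Rightarrow> nat" and \<Xi> :: "real list"
    and s :: "real \<Rightarrow> real" and TOL :: real
  assumes "p \<ge> 1"
    and "length \<zeta> \<ge> 2" and "sorted_wrt (<) \<zeta>"
    and "\<And>j. j \<in> {2..length \<zeta> - 1} \<Longrightarrow> 1 \<le> m j \<and> m j \<le> p + 1"
    and "basic_knot_vector p \<zeta> m \<Xi>"
    and "s \<in> spline_space p \<zeta> m"
    and "TOL > 0"
  shows "algorithm_finishes p TOL (control_points p \<Xi> s) \<Xi> \<and>
    (\<forall>c' \<Xi>'. algorithm_returns p TOL (control_points p \<Xi> s) \<Xi> c' \<Xi>' \<longrightarrow>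
       length c' = spline_dim p \<Xi>' \<and>
       spline p \<Xi>' c' \<in> spline_space_of_knots p \<Xi>' \<and>
       Linf_norm (hd \<zeta>) (last \<zeta>) (\<lambda>x. s x - spline p \<Xi>' c' x) < ereal TOL)"
proof -
  have "\<forall>j\<in>{2..length \<zeta> - 1}. 1 \<le> m j \<and> m j \<le> p + 1" using assms(4) by blast
  note kv = basic_knot_vector[OF assms(2,3) this assms(5)]
  define a where "a = hd \<zeta>"
  define b where "b = last \<zeta>"
  define km where "km = max_removals p \<Xi>"
  define c where "c = control_points p \<Xi> s"
  have "s \<in> spline_space_of_knots p \<Xi>"
    using assms(6) kv(3) unfolding spline_space_of_knots_def kv(2) by (simp add: spline_space_def)
  from knot_vector.spline_space_coeffs[OF kv(1) this] kv(4,5)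
  obtain c0 where c0: "length c0 = spline_dim p \<Xi>" "\<And>x. x \<in> {a..b} \<Longrightarrow> s x = spline p \<Xi> c0 x"
    unfolding a_def b_def by auto
  then have "c = c0"
    unfolding c_def using knot_vector.control_points_eq[OF kv(1) c0(1)] kv(4,5) by (simp add: a_def b_def)
  with c0 have c: "length c = spline_dim p \<Xi>" "\<And>x. x \<in> {a..b} \<Longrightarrow> s x = spline p \<Xi> c x" by auto
  \<comment> \<open>The ends \<open>a\<close> and \<open>b\<close> are recorded because the knot
    vector changes while the norm stays on \<open>[a, b]\<close>. Positivity of \<open>tol\<close>
    yields the strict inequality at the end.\<close>
  define inv where "inv st = (case st of (k, tol, c', \<Xi>') \<Rightarrow> knot_vector p \<Xi>' \<and>
     length c' = spline_dim p \<Xi>' \<and> 0 < tol \<and> knot \<Xi>' (p+1) = a \<and> knot \<Xi>' (spline_dim p \<Xi>' + 1) = b \<and>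
     (\<forall>x\<in>{a..b}. \<bar>s x - spline p \<Xi>' c' x\<bar> \<le> TOL - tol))" for st :: state
  have inv_init: "inv (0, TOL, c, \<Xi>)"
    using kv c assms(7) by (simp add: inv_def a_def b_def)
  have inv_step: "inv st'" if step: "loop_step p km st st'" and "inv st" for st st'
    using step
  proof cases
    case (1 k \<Xi>' c' j \<epsilon> tol i l z)
    interpret V: knot_vector p \<Xi>' using \<open>inv st\<close> 1 by (simp add: inv_def)
    have c': "length c' = V.n" and tol: "0 < tol" and ends: "V.t (p+1) = a" "V.t (V.n+1) = b"
      and err: "\<And>x. x \<in> {a..b} \<Longrightarrow> \<bar>s x - spline p \<Xi>' c' x\<bar> \<le> TOL - tol"
      using \<open>inv st\<close> 1 by (auto simp: inv_def)
    have j: "j \<in> {2..V.N-1}" using 1(4) by (simp add: best_index_def is_arg_min_def)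
    note idx = V.removal_index[OF j, folded 1(7,8)]
    have z: "length z = p + 1 - l" using 1(9) by (simp add: is_arg_min_def)
    note st = V.removal_step[OF j c', folded 1(7,8), OF z]
    have "loc_residual p \<Xi>' i l c' z \<le> \<epsilon>"
      using V.residual_le_knot_removal_error[OF j c', folded 1(7,8), OF 1(9)] 1(5) by simp
    with st(2) have "\<bar>spline p \<Xi>' c' x - spline p (remove_index i \<Xi>') (take (i - p - 2) c' @ z @ drop (i - l) c') x\<bar> \<le> \<epsilon>"
      if "x \<in> {a..b}" for x using that ends by force
    with err have "\<bar>s x - spline p (remove_index i \<Xi>') (take (i - p - 2) c' @ z @ drop (i - l) c') x\<bar> \<le> TOL - (tol - \<epsilon>)"
      if "x \<in> {a..b}" for x using that by (smt (verit))
    moreover have "knot_vector p (remove_index i \<Xi>')" by (rule V.knot_vector_removed[OF idx(1)])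
    ultimately show ?thesis
      unfolding 1(2) inv_def using st(1) V.removed_ends[OF idx(1)] ends 1(6) by simp
  qed
  have inv: "inv st" if "(loop_step p km)\<^sup>*\<^sup>* (0, TOL, c, \<Xi>) st" for st
    using that by induction (use inv_init inv_step in auto)
  have "\<not> (\<exists>\<sigma>. \<sigma> 0 = (0, TOL, c, \<Xi>) \<and> (\<forall>k. loop_step p km (\<sigma> k) (\<sigma> (Suc k))))"
  proof (intro notI, elim exE conjE)
    fix \<sigma> assume \<sigma>: "\<sigma> 0 = (0, TOL, c, \<Xi>)" "\<forall>k. loop_step p km (\<sigma> k) (\<sigma> (Suc k))"
    \<comment> \<open>The counter grows by one per step and must be below \<open>km\<close> for a
      step, so the state of index \<open>km\<close> has no successor.\<close>
    have fst: "fst st' = Suc (fst st) \<and> fst st < km" if "loop_step p km st st'" for st st'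
      using that by cases simp
    have "fst (\<sigma> k) = k" for k
    proof (induction k)
      case (Suc k)
      then show ?case using fst[OF spec[OF \<sigma>(2), of k]] by simp
    qed (simp add: \<sigma>(1))
    with \<sigma>(2) fst[of "\<sigma> km" "\<sigma> (Suc km)"] show False by simp
  qed
  moreover have "\<exists>st'. loop_step p km st st'"
    if "(loop_step p km)\<^sup>*\<^sup>* (0, TOL, c, \<Xi>) st" "loop_condition p km st" for st
  proof -
    obtain k tol c' \<Xi>' where st: "st = (k, tol, c', \<Xi>')" by (cases st) auto
    from that(2) obtain j where k: "k < km" and j: "best_index p \<Xi>' c' j"
      "knot_removal_error p \<Xi>' j (spline p \<Xi>' c') < tol" by (auto simp: st)
    interpret V: knot_vector p \<Xi>' using inv[OF that(1)] by (simp add: inv_def st)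
    have j': "j \<in> {2..V.N-1}" using j(1) by (simp add: best_index_def is_arg_min_def)
    obtain z where "is_arg_min (loc_residual p \<Xi>' (last_knot_index p \<Xi>' j) (knot_mult p \<Xi>' j - 1) c')
      (\<lambda>z. length z = p + 1 - (knot_mult p \<Xi>' j - 1)) z"
      using V.ex_minimizer[OF j'] by blast
    from loop_step.intros[OF k j(1) refl j(2) refl refl this] show ?thesis unfolding st by blast
  qed
  ultimately have "algorithm_finishes p TOL c \<Xi>"
    by (simp add: algorithm_finishes_def km_def[symmetric])
  moreover have "length c' = spline_dim p \<Xi>' \<and> spline p \<Xi>' c' \<in> spline_space_of_knots p \<Xi>' \<and>
      Linf_norm a b (\<lambda>x. s x - spline p \<Xi>' c' x) < ereal TOL"
    if ret: "algorithm_returns p TOL c \<Xi> c' \<Xi>'" for c' \<Xi>'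
  proof -
    obtain k tol where "inv (k, tol, c', \<Xi>')"
      using ret inv unfolding algorithm_returns_def km_def[symmetric] by blast
    then have V: "knot_vector p \<Xi>'" "length c' = spline_dim p \<Xi>'" "0 < tol"
      and err: "\<And>x. x \<in> {a..b} \<Longrightarrow> \<bar>s x - spline p \<Xi>' c' x\<bar> \<le> TOL - tol" by (auto simp: inv_def)
    have "Linf_norm a b (\<lambda>x. s x - spline p \<Xi>' c' x) \<le> ereal (TOL - tol)"
      by (rule Linf_norm_le[OF err, where g="\<lambda>x. spline p \<Xi> c x - spline p \<Xi>' c' x"])
         (use c(2) in \<open>auto intro!: borel_measurable_diff borel_measurable_spline\<close>)
    also have "\<dots> < ereal TOL" using V(3) by simp
    finally show ?thesis using V knot_vector.spline_in_spline_space[OF V(1)] by blast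
  qed
  ultimately show ?thesis unfolding c_def a_def b_def by blast
qed

end
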